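(* Let $r$ and $s$ be two positive integers with $r+s\equiv 0 \pmod{24}$. Let $\tau$ be in the upper half-plane and $q=e^{2\pi i\tau}$. If $r+s\equiv 0\pmod 5$, then $$T_5\big(\eta(r\tau)\eta(s\tau)\big)=\eta(r\tau)\eta(s\tau)\left(q^{-(r+s)/60}U(r,s)\right)^2,$$ and if $r-s\equiv 0\pmod 5$, then $$T_5\big(\eta(r\tau)\eta(s\tau)\big)=-\eta(r\tau)\eta(s\tau)\left(q^{(11r-s)/60}U(r,s)\right)^2 .$$
   Context: For $|q|<1$, $(a;q)_\infty=\prod_{k\ge0}(1-aq^k)$ and $(a;q)_n=\prod_{k=0}^{n-1}(1-aq^k)$. The Rogers--Ramanujan functions are $G(q)=\sum_{n\ge0}\frac{q^{n^2}}{(q;q)_n}=\frac{1}{(q;q^5)_\infty(q^4;q^5)_\infty}$ and $H(q)=\sum_{n\ge0}\frac{q^{n(n+1)}}{(q;q)_n}=\frac{1}{(q^2;q^5)_\infty(q^3;q^5)_\infty}$. For positive integers $r,s$, $$U(r,s)=U(r,s,q)=\begin{cases} G(q^r)G(q^s)+q^{(s+r)/5}H(q^r)H(q^s) & \text{if } s+r\equiv0\pmod5,\\ H(q^r)G(q^s)-q^{(s-r)/5}G(q^r)H(q^s) & \text{if } s-r\equiv 0\pmod 5.\end{cases}$$ The Dedekind eta function is $\eta(\tau)=\sum_{n=-\infty}^{\infty}(-1)^nq^{(6n-1)^2/24}=q^{1/24}(q;q)_\infty$ with $q=e^{2\pi i\tau}$, $\operatorname{Im}\tau>0$. For a $q$-series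 $\sum_{n\ge0}a(n)q^n$, the Hecke operator $T_5$ is $T_5\left(\sum_{n\ge0}a(n)q^n\right)=\sum_{n\ge0}\big(a(5n)+a(n/5)\big)q^n$, where $a(k)=0$ if $k$ is not an integer.
   Formalization: The case where 5 divides both r and s is excluded: there both congruences hold, the two formulas for U(r,s) conflict, and the identities fail (e.g. r = s = 60). *)

theory Defs
  imports "HOL-Analysis.Analysis" "HOL-Number_Theory.Cong"
begin

definition qpoch :: "complex \<Rightarrow> complex \<Rightarrow> nat \<Rightarrow> complex" where
  "qpoch a q n = (\<Prod>k<n. 1 - a * q ^ k)"

definition qpoch_inf :: "complex \<Rightarrow> complex \<Rightarrow> complex" where
  "qpoch_inf a q = (\<Prod>k. 1 - a * q ^ k)"

definition RR_G :: "complex \<Rightarrow> complex" where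
  "RR_G q = (\<Sum>n. q ^ (n ^ 2) / qpoch q q n)"

definition RR_H :: "complex \<Rightarrow> complex" where
  "RR_H q = (\<Sum>n. q ^ (n * (n + 1)) / qpoch q q n)"

text \<open>
  Both divisions below are exact in their branches. The two congruences hold simultaneously
  precisely when 5 divides both \<open>r\<close> and \<open>s\<close>; the two formulas then disagree, so the value of
  \<open>RR_U\<close> is only meaningful outside that case.
\<close>

definition RR_U :: "nat \<Rightarrow> nat \<Rightarrow> complex \<Rightarrow> complex" where
  "RR_U r s q =
    (if [s + r = 0] (mod 5) then
       RR_G (q ^ r) * RR_G (q ^ s) + q ^ ((s + r) div 5) * RR_H (q ^ r) * RR_H (q ^ s)
     else if [int s - int r = 0] (mod 5) then
       RR_H (q ^ r) * RR_G (q ^ s)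
         - q powi ((int s - int r) div 5) * RR_G (q ^ r) * RR_H (q ^ s)
     else undefined)"

text \<open>
  The power \<open>q\<^sup>x\<close> for \<open>q = exp (2\<pi>i\<tau>)\<close> and real \<open>x\<close>. The branch is determined by \<open>\<tau>\<close>, not
  by the principal logarithm of \<open>q\<close>.
\<close>

definition q_pow :: "complex \<Rightarrow> real \<Rightarrow> complex" where
  "q_pow \<tau> x = exp (2 * of_real pi * \<i> * \<tau> * of_real x)"

definition dedekind_eta :: "complex \<Rightarrow> complex" where
  "dedekind_eta \<tau> = q_pow \<tau> (1 / 24) * qpoch_inf (q_pow \<tau> 1) (q_pow \<tau> 1)"

definition has_q_expansion :: "(complex \<Rightarrow> complex) \<Rightarrow> (nat \<Rightarrow> complex) \<Rightarrow> bool" where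
  "has_q_expansion f a \<longleftrightarrow> (\<forall>\<tau>. Im \<tau> > 0 \<longrightarrow> (\<lambda>n. a n * q_pow \<tau> 1 ^ n) sums f \<tau>)"

lemma has_q_expansion_unique:
  assumes "has_q_expansion f a" "has_q_expansion f b"
  shows   "a = b"
proof (rule ccontr)
  assume "a \<noteq> b"
  define c where "c = (\<lambda>n. a n - b n)"
  have sums_0: "(\<lambda>n. c n * z ^ n) sums 0" if z: "z \<noteq> 0" "norm z < 1" for z
  proof -
    define \<tau> where "\<tau> = Ln z / (2 * of_real pi * \<i>)"
    have "Im \<tau> = - ln (norm z) / (2 * pi)"
      using z by (simp add: \<tau>_def Im_divide power2_eq_square)
    also have "\<dots> > 0"
      using z by (simp add: divide_neg_pos)
    finally have "Im \<tau> > 0" .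
    moreover have "q_pow \<tau> 1 = z"
      using z by (simp add: q_pow_def \<tau>_def)
    ultimately have "(\<lambda>n. a n * z ^ n) sums f \<tau>" "(\<lambda>n. b n * z ^ n) sums f \<tau>"
      using assms by (auto simp: has_q_expansion_def)
    from sums_diff[OF this] show ?thesis
      by (simp add: c_def algebra_simps)
  qed
  obtain m where m: "c m \<noteq> 0" "\<And>k. k < m \<Longrightarrow> c k = 0"
    proof -
    obtain k where "c k \<noteq> 0"
      using \<open>a \<noteq> b\<close> by (auto simp: c_def fun_eq_iff)
    thus ?thesis
      using that[of "LEAST n. c n \<noteq> 0"] LeastI[of "\<lambda>n. c n \<noteq> 0" k] not_less_Least by blast
  qed
  define d where "d = (\<lambda>n. c (n + m))"
  have d_sums: "(\<lambda>n. d n * z ^ n) sums 0" if z: "z \<noteq> 0" "norm z < 1" for z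
  proof -
    have "(\<lambda>n. c (n + m) * z ^ (n + m)) sums 0"
      using sums_0[OF z] m(2) by (subst sums_iff_shift) simp
    from sums_divide[OF this, of "z ^ m"] show ?thesis
      using z by (simp add: d_def power_add)
  qed
  have d_summable: "summable (\<lambda>n. d n * z ^ n)" if "norm z < 1" for z
    using d_sums[of z] that by (cases "z = 0") (auto simp: sums_iff)
  have "((\<lambda>z. \<Sum>n. d n * z ^ n) \<longlongrightarrow> d 0) (at 0)"
    by (rule powser_limit_0_strong[of 1]) (use d_summable in \<open>auto intro: summable_sums\<close>)
  moreover have "eventually (\<lambda>z. (\<Sum>n. d n * z ^ n) = 0) (at 0)"
    unfolding eventually_at by (rule exI[of _ 1]) (use d_sums in \<open>auto simp: sums_iff\<close>)
  ultimately have "d 0 = 0"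
    using tendsto_unique[OF _ _ tendsto_eventually, of "at 0"] by force
  with m show False by (simp add: d_def)
qed

definition hecke_T5_coeff :: "(nat \<Rightarrow> complex) \<Rightarrow> nat \<Rightarrow> complex" where
  "hecke_T5_coeff a n = a (5 * n) + (if 5 dvd n then a (n div 5) else 0)"

definition hecke_T5 :: "(complex \<Rightarrow> complex) \<Rightarrow> complex \<Rightarrow> complex" where
  "hecke_T5 f \<tau> =
    (let a = (THE a. has_q_expansion f a) in \<Sum>n. hecke_T5_coeff a n * q_pow \<tau> 1 ^ n)"

end

theory Submission
  imports Defs
begin

text \<open>
  Write \<open>E(q) = (q;q)\<^sub>\<infinity>\<close> and \<open>u = G(q\<^sup>5)\<close>, \<open>v = q H(q\<^sup>5)\<close>. Everything follows from the 5-dissection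
  \<open>E(q) = E(q\<^sup>5) (u\<^sup>2 - u v - v\<^sup>2)\<close> together with \<open>E(q\<^sup>5) u v = q E(q\<^sup>2\<^sup>5)\<close>. Let \<open>r + s = 24 N\<close>, and let
  \<open>u'\<close>, \<open>v'\<close> and \<open>u''\<close>, \<open>v''\<close> be \<open>u\<close>, \<open>v\<close> at the \<open>r\<close>-th and \<open>s\<close>-th power of \<open>q\<close>. Of the nine terms in
  the product of the dissections of \<open>E(q\<^sup>r)\<close> and \<open>E(q\<^sup>s)\<close>, exactly three have an exponent that,
  after adding \<open>N\<close>, is divisible by 5. The remaining term of the Hecke operator is a second copy of
  the middle one of these, which completes a square:
  \<open>(u' u'')\<^sup>2 + 2 u' v' u'' v'' + (v' v'')\<^sup>2\<close> or \<open>- (u' v'')\<^sup>2 + 2 u' v' u'' v'' - (v' u'')\<^sup>2\<close>.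

  The relation \<open>E(q\<^sup>5) = E(q) G(q) H(q)\<close> comes from the Rogers--Ramanujan identities, proved by iterating
  Bailey's lemma on the finite form of the Jacobi triple product. The dissection is Euler's
  pentagonal number theorem split modulo 5 and summed by the quintuple product identity.
\<close>

section \<open>Sums over infinite sets\<close>

lemma has_sum_sum:
  fixes f :: "'i \<Rightarrow> 'a \<Rightarrow> 'b :: topological_comm_monoid_add"
  assumes "\<And>i. i \<in> I \<Longrightarrow> (f i has_sum S i) A"
  shows "((\<lambda>x. \<Sum>i\<in>I. f i x) has_sum (\<Sum>i\<in>I. S i)) A"
  using assms by (induction I rule: infinite_finite_induct) (auto intro!: has_sum_add)

lemma has_sum_UNIV_translate:
  fixes f :: "'a :: ab_group_add \<Rightarrow> 'b :: {comm_monoid_add, topological_space}"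
  shows "((\<lambda>x. f (x + a)) has_sum S) UNIV \<longleftrightarrow> (f has_sum S) UNIV"
  by (rule has_sum_reindex_bij_witness[of _ "\<lambda>x. x - a" "\<lambda>x. x + a"]) auto

lemma has_sum_int_residue_class:
  fixes f :: "int \<Rightarrow> 'b :: {comm_monoid_add, topological_space}"
  assumes "m > 0"
  shows "((\<lambda>k. f (m * k + j)) has_sum S) UNIV \<longleftrightarrow> (f has_sum S) {n. n mod m = j mod m}"
proof (rule has_sum_reindex_bij_witness[of _ "\<lambda>n. (n - j) div m" "\<lambda>k. m * k + j"])
  fix n assume "n \<in> {n. n mod m = j mod m}"
  hence "m dvd n - j"
    by (simp add: mod_eq_dvd_iff)
  thus "m * ((n - j) div m) + j = n"
    by simp
qed (use assms in auto)

lemma infsum_split_Collect: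
  fixes f :: "'a \<Rightarrow> 'b :: banach"
  assumes "f summable_on UNIV"
  shows "infsum f UNIV = infsum f {x. P x} + infsum f {x. \<not> P x}"
proof -
  have "infsum f ({x. P x} \<union> {x. \<not> P x}) = infsum f {x. P x} + infsum f {x. \<not> P x}"
    using summable_on_subset_banach[OF assms subset_UNIV] by (intro infsum_Un_disjoint) auto
  thus ?thesis
    by (simp add: Collect_disj_eq[symmetric])
qed

lemma sums_infsum_fibres:
  fixes w :: "'a \<Rightarrow> 'b :: {real_normed_field, banach}" and e :: "'a \<Rightarrow> nat"
  assumes "((\<lambda>i. w i * x ^ e i) has_sum S) I"
  shows "(\<lambda>n. infsum w {i \<in> I. e i = n} * x ^ n) sums S"
proof -
  let ?F = "\<lambda>i. w i * x ^ e i" and ?B = "\<lambda>n. {i \<in> I. e i = n}"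
  have "((\<lambda>(n, i). ?F i) has_sum S) (Sigma UNIV ?B) \<longleftrightarrow> (?F has_sum S) I"
    by (rule has_sum_reindex_bij_witness[of _ "\<lambda>i. (e i, i)" snd]) auto
  hence "((\<lambda>(n, i). ?F i) has_sum S) (Sigma UNIV ?B)"
    using assms by simp
  moreover have "((\<lambda>i. (\<lambda>(n, i). ?F i) (n, i)) has_sum infsum w (?B n) * x ^ n) (?B n)" for n
  proof -
    have "?F summable_on ?B n"
      by (rule summable_on_subset_banach[OF has_sum_imp_summable[OF assms]]) auto
    moreover have "infsum ?F (?B n) = infsum (\<lambda>i. w i * x ^ n) (?B n)"
      by (rule infsum_cong) auto
    ultimately show ?thesis
      by (simp add: has_sum_iff infsum_cmult_left')
  qed
  ultimately have "((\<lambda>n. infsum w (?B n) * x ^ n) has_sum S) UNIV"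
    by (rule has_sum_SigmaD)
  thus ?thesis by (rule has_sum_imp_sums)
qed

lemma has_sum_mult_Times:
  fixes f :: "'a \<Rightarrow> complex" and g :: "'b \<Rightarrow> complex"
  assumes has_sum_f: "(f has_sum S) A" and has_sum_g: "(g has_sum T) B"
  shows "((\<lambda>(x, y). f x * g y) has_sum S * T) (A \<times> B)"
proof (rule has_sum_SigmaI)
  have abs_summable: "(\<lambda>x. norm (f x)) summable_on A" "(\<lambda>y. norm (g y)) summable_on B"
    using has_sum_imp_summable[OF has_sum_f] has_sum_imp_summable[OF has_sum_g]
    by (simp_all add: summable_on_iff_abs_summable_on_complex)
  have "(\<lambda>x. norm (f x) * infsum (\<lambda>y. norm (g y)) B) summable_on A"
    by (intro summable_on_cmult_left abs_summable)
  hence "(\<lambda>z. norm (case z of (x, y) \<Rightarrow> f x * g y)) summable_on A \<times> B"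
    using has_sum_cmult_right[OF has_sum_infsum[OF abs_summable(2)]]
    by (intro summable_on_SigmaI) (auto simp: norm_mult)
  thus "(\<lambda>(x, y). f x * g y) summable_on A \<times> B"
    by (rule abs_summable_summable)
  show "((\<lambda>y. (\<lambda>(x, y). f x * g y) (x, y)) has_sum f x * T) B" for x
    using has_sum_cmult_right[OF has_sum_g] by simp
  show "((\<lambda>x. f x * T) has_sum S * T) A"
    by (rule has_sum_cmult_left[OF has_sum_f])
qed

lemma infsum_dominated_convergence:
  fixes f :: "nat \<Rightarrow> 'a \<Rightarrow> 'b :: {banach, second_countable_topology}"
  assumes lim: "\<And>x. x \<in> A \<Longrightarrow> (\<lambda>n. f n x) \<longlonglongrightarrow> g x"
    and bound: "\<And>n x. x \<in> A \<Longrightarrow> norm (f n x) \<le> M x"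
    and summable: "M summable_on A"
  shows "(\<lambda>n. infsum (f n) A) \<longlonglongrightarrow> infsum g A"
proof -
  have limit_bound: "norm (g x) \<le> M x" if "x \<in> A" for x
    by (rule Lim_bounded[OF tendsto_norm[OF lim], of _ 0]) (use bound that in auto)
  have "(\<lambda>n. infsetsum (f n) A) \<longlonglongrightarrow> infsetsum g A"
    unfolding infsetsum_def
  proof (rule integral_dominated_convergence[where w = M])
    have "(\<lambda>x. norm (M x)) summable_on A"
      using summable by (rule summable_on_iff_abs_summable_on_real[THEN iffD1])
    thus "integrable (count_space A) M"
      using abs_summable_equivalent[of M A] unfolding Infinite_Set_Sum.abs_summable_on_def by blast
  qed (use lim bound in \<open>auto simp: AE_count_space\<close>)
  moreover have "(\<lambda>x. norm (f n x)) summable_on A" "(\<lambda>x. norm (g x)) summable_on A" for n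
    using Infinite_Sum.abs_summable_on_comparison_test'[OF summable] bound limit_bound by auto
  ultimately show ?thesis
    by (simp add: infsetsum_infsum abs_summable_equivalent)
qed

section \<open>Theta series\<close>

definition nome :: "complex \<Rightarrow> bool" where
  "nome q \<longleftrightarrow> q \<noteq> 0 \<and> norm q < 1"

lemma nomeD:
  assumes "nome q"
  shows nome_nonzero: "q \<noteq> 0" and nome_norm_less_1: "norm q < 1"
  using assms by (simp_all add: nome_def)

lemma nome_power: "nome q \<Longrightarrow> n > 0 \<Longrightarrow> nome (q ^ n)"
  by (simp add: nome_def norm_power power_less_one_iff)

lemma nome_power_neq_1: "nome q \<Longrightarrow> n > 0 \<Longrightarrow> q ^ n \<noteq> 1"
  using power_eq_1_iff[of q n] by (auto simp: nome_def)

definition tri :: "int \<Rightarrow> int" where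
  "tri n = n * (n - 1) div 2"

lemma two_mult_tri: "2 * tri n = n * n - n"
  by (simp add: tri_def right_diff_distrib)

lemma tri_eqI: "2 * e = n * n - n \<Longrightarrow> tri n = e"
  using two_mult_tri[of n] by linarith

lemma tri_add: "tri (m + n) = tri m + tri n + m * n"
  using two_mult_tri[of m] two_mult_tri[of n]
  by (intro tri_eqI) (simp add: algebra_simps)

lemma tri_mult: "tri (m * n) = m * m * tri n + n * tri m"
proof (rule tri_eqI)
  have "2 * (m * m * tri n + n * tri m) =
      m * m * (2 * tri n) + n * (2 * tri m)"
    by (simp only: distrib_left mult_ac)
  thus "2 * (m * m * tri n + n * tri m) = m * n * (m * n) - m * n"
    unfolding two_mult_tri by (simp add: algebra_simps)
qed

lemma tri_uminus: "tri (- n) = tri n + n"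
  using two_mult_tri[of n] by (intro tri_eqI) (simp add: algebra_simps)

definition theta_term :: "complex \<Rightarrow> complex \<Rightarrow> int \<Rightarrow> complex" where
  "theta_term p z n = p powi tri n * z powi n"

definition theta :: "complex \<Rightarrow> complex \<Rightarrow> complex" where
  "theta p z = infsum (theta_term p z) UNIV"

lemma theta_term_0 [simp]: "theta_term p z 0 = 1" and theta_term_1 [simp]: "theta_term p z 1 = z"
  by (simp_all add: theta_term_def tri_eqI)

lemma theta_term_add:
  assumes "p \<noteq> 0" "z \<noteq> 0"
  shows "theta_term p z (m + n) = theta_term p z m * theta_term p (p powi m * z) n"
  using assms
  by (simp add: theta_term_def tri_add power_int_add power_int_mult power_int_mult_distrib)

lemma theta_term_mult:
  assumes "p \<noteq> 0"
  shows "theta_term p z (m * n) = theta_term (p powi (m * m)) (p powi tri m * z powi m) n"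
proof -
  have "p powi (m * m * tri n) = (p powi (m * m)) powi tri n"
    by (rule power_int_mult)
  thus ?thesis
    using assms
    by (simp add: theta_term_def tri_mult power_int_add power_int_mult_distrib
          mult.commute[of n] flip: power_int_mult)
qed

lemma theta_term_uminus:
  assumes "p \<noteq> 0" "z \<noteq> 0"
  shows "theta_term p z (- n) = theta_term p (p / z) n"
  using assms
  by (simp add: theta_term_def tri_uminus power_int_add power_int_divide_distrib
        power_int_minus field_simps)

lemma summable_theta_term_nat:
  assumes "nome p" "z \<noteq> 0"
  shows "summable (\<lambda>k. norm (theta_term p z (int k)))"
proof -
  have "(\<lambda>k. norm p ^ k * norm z) \<longlonglongrightarrow> 0"
    using nome_norm_less_1[OF assms(1)] by (intro tendsto_mult_left_zero LIMSEQ_power_zero) simp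
  hence "eventually (\<lambda>k. norm p ^ k * norm z < 1 / 2) sequentially"
    by (rule order_tendstoD) simp
  then obtain N where ratio_bound: "\<And>k. k \<ge> N \<Longrightarrow> norm p ^ k * norm z < 1 / 2"
    by (auto simp: eventually_sequentially)
  show ?thesis
  proof (rule summable_ratio_test[of "1/2" N])
    fix k assume "k \<ge> N"
    have "norm (theta_term p z (int (Suc k))) = norm p ^ k * norm z * norm (theta_term p z (int k))"
      using theta_term_add[OF nome_nonzero[OF assms(1)] assms(2), of "int k" 1]
      by (simp add: norm_mult norm_power add.commute)
    also have "\<dots> \<le> 1 / 2 * norm (theta_term p z (int k))"
      using ratio_bound[OF \<open>k \<ge> N\<close>] by (intro mult_right_mono) auto
    finally show "norm (norm (theta_term p z (int (Suc k)))) \<le>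
        1 / 2 * norm (norm (theta_term p z (int k)))"
      by simp
  qed auto
qed

lemma has_sum_theta:
  assumes "nome p" "z \<noteq> 0"
  shows "(theta_term p z has_sum theta p z) UNIV"
proof -
  have summable_nonneg: "(\<lambda>k. theta_term p w (int k)) summable_on UNIV" if "w \<noteq> 0" for w
    by (intro norm_summable_imp_summable_on summable_theta_term_nat assms that)
  have "theta_term p z summable_on range int"
    using summable_nonneg[OF assms(2)] by (subst summable_on_reindex) (auto simp: o_def)
  moreover have "theta_term p z summable_on range (\<lambda>k. - int k)"
    using summable_nonneg[of "p / z"] assms nome_nonzero
    by (subst summable_on_reindex) (auto simp: o_def inj_def theta_term_uminus)
  ultimately have "theta_term p z summable_on (range int \<union> range (\<lambda>k. - int k))"
    by (rule summable_on_union)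
  moreover have "n \<in> range int \<union> range (\<lambda>k. - int k)" for n :: int
    by (cases n rule: int_cases2) auto
  hence "range int \<union> range (\<lambda>k. - int k) = UNIV"
    by blast
  ultimately show ?thesis
    by (simp add: theta_def)
qed

lemma theta_reflect:
  assumes "p \<noteq> 0" "z \<noteq> 0"
  shows "theta p (p / z) = theta p z"
  unfolding theta_def
  by (rule infsum_reindex_bij_witness[of _ uminus uminus])
     (auto simp: theta_term_uminus[OF assms, symmetric])

lemma has_sum_theta_term_residue_class:
  assumes "nome p" "z \<noteq> 0" "m > 0"
  shows "(theta_term p z has_sum
      theta_term p z j * theta (p ^ (m * m)) (p powi tri (int m) * (p powi j * z) ^ m))
    {n. n mod int m = j mod int m}"
proof -
  have nome: "p \<noteq> 0" "nome (p ^ (m * m))"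
    using assms nome_nonzero nome_power by auto
  have "theta_term p z (int m * k + j) =
      theta_term p z j * theta_term (p ^ (m * m)) (p powi tri (int m) * (p powi j * z) ^ m) k" for k
    using theta_term_mult[OF nome(1), of "p powi j * z" "int m" k]
      theta_term_add[OF nome(1) assms(2), of j "int m * k"]
    by (simp add: add.commute flip: of_nat_mult)
  moreover have "((\<lambda>k. theta_term p z j *
        theta_term (p ^ (m * m)) (p powi tri (int m) * (p powi j * z) ^ m) k) has_sum
      theta_term p z j * theta (p ^ (m * m)) (p powi tri (int m) * (p powi j * z) ^ m)) UNIV"
    using nome assms by (intro has_sum_cmult_right has_sum_theta) auto
  ultimately show ?thesis
    using assms by (simp flip: has_sum_int_residue_class)
qed

section \<open>q-Pochhammer symbols\<close>

lemma qpoch_0 [simp]: "qpoch a q 0 = 1"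
  by (simp add: qpoch_def)

lemma qpoch_Suc: "qpoch a q (Suc n) = qpoch a q n * (1 - a * q ^ n)"
  by (simp add: qpoch_def)

lemma qpoch_add: "qpoch a q (m + n) = qpoch a q m * qpoch (a * q ^ m) q n"
  by (induction n) (simp_all add: qpoch_Suc power_add mult_ac)

lemma qpoch_eq_0:
  assumes "k < n" "a * q ^ k = 1"
  shows "qpoch a q n = 0"
  unfolding qpoch_def using assms by (intro prod_zero) (auto intro!: bexI[of _ k])

lemma convergent_prod_qpoch:
  fixes a q :: complex
  assumes "norm q < 1"
  shows "convergent_prod (\<lambda>k. 1 - a * q ^ k)"
proof -
  have "summable (\<lambda>k. norm a * norm q ^ k)"
    using assms by (intro summable_mult summable_geometric) auto
  hence "summable (\<lambda>k. norm ((1 - a * q ^ k) - 1))"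
    by (simp add: norm_mult norm_power)
  thus ?thesis
    by (intro abs_convergent_prod_imp_convergent_prod summable_imp_abs_convergent_prod)
qed

lemma qpoch_tendsto:
  assumes "norm q < 1"
  shows "qpoch a q \<longlonglongrightarrow> qpoch_inf a q"
proof -
  have "(\<lambda>n. qpoch a q (Suc n)) \<longlonglongrightarrow> qpoch_inf a q"
    using convergent_prod_LIMSEQ[OF convergent_prod_qpoch[OF assms, of a]]
    unfolding qpoch_def qpoch_inf_def lessThan_Suc_atMost .
  thus ?thesis by (rule LIMSEQ_imp_Suc)
qed

lemma qpoch_inf_nonzero:
  assumes "norm q < 1" "\<And>k. a * q ^ k \<noteq> 1"
  shows "qpoch_inf a q \<noteq> 0"
  unfolding qpoch_inf_def
  by (rule prodinf_nonzero[OF convergent_prod_qpoch[OF assms(1)]]) (use assms(2) in auto)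

lemma qpoch_mult_eq_prod: "qpoch a q (n * m) = (\<Prod>j<m. qpoch (a * q ^ j) (q ^ m) n)"
proof (induction n)
  case (Suc n)
  have "qpoch a q (Suc n * m) = qpoch a q (n * m) * qpoch (a * q ^ (n * m)) q m"
    using qpoch_add[of a q "n * m" m] by (simp add: add.commute)
  also have "\<dots> = (\<Prod>j<m. qpoch (a * q ^ j) (q ^ m) n) * (\<Prod>j<m. 1 - a * q ^ (n * m) * q ^ j)"
    unfolding Suc.IH by (simp only: qpoch_def)
  finally show ?case
    by (simp add: qpoch_Suc prod.distrib mult_ac flip: power_mult)
qed simp

lemma qpoch_inf_dissect:
  assumes "norm q < 1" "m > 0"
  shows "qpoch_inf a q = (\<Prod>j<m. qpoch_inf (a * q ^ j) (q ^ m))"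
proof (rule LIMSEQ_unique)
  have "filterlim (\<lambda>n. n * m) sequentially sequentially"
    using assms by (intro filterlim_subseq) (auto simp: strict_mono_def)
  thus "(\<lambda>n. qpoch a q (n * m)) \<longlonglongrightarrow> qpoch_inf a q"
    by (rule filterlim_compose[OF qpoch_tendsto[OF assms(1)]])
  have "norm (q ^ m) < 1"
    using assms by (simp add: norm_power power_less_one_iff)
  thus "(\<lambda>n. qpoch a q (n * m)) \<longlonglongrightarrow> (\<Prod>j<m. qpoch_inf (a * q ^ j) (q ^ m))"
    unfolding qpoch_mult_eq_prod by (intro tendsto_prod qpoch_tendsto)
qed

abbreviation euler_prod :: "complex \<Rightarrow> complex" where
  "euler_prod q \<equiv> qpoch_inf q q"

lemma euler_prod_nonzero:
  assumes "nome q"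
  shows "euler_prod q \<noteq> 0"
  using nome_power_neq_1[OF assms, of "Suc k" for k] nome_norm_less_1[OF assms]
  by (intro qpoch_inf_nonzero) auto

definition inv_qfact :: "complex \<Rightarrow> int \<Rightarrow> complex" where
  "inv_qfact q k = (if k < 0 then 0 else 1 / qpoch q q (nat k))"

lemma inv_qfact_neg [simp]: "k < 0 \<Longrightarrow> inv_qfact q k = 0"
  and inv_qfact_0 [simp]: "inv_qfact q 0 = 1"
  by (auto simp: inv_qfact_def)

lemma inv_qfact_of_nat: "inv_qfact q (int n) = 1 / qpoch q q n"
  by (simp add: inv_qfact_def)

lemma inv_qfact_diff_1:
  assumes "nome q"
  shows "inv_qfact q (k - 1) = (1 - q powi k) * inv_qfact q k"
proof (cases "k \<le> 0")
  case True
  thus ?thesis by (cases "k = 0") auto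
next
  case False
  then obtain n where k_eq: "k = int (Suc n)"
    by (metis not_le zero_less_imp_eq_int gr0_conv_Suc)
  have "q powi k = q * q ^ n"
    unfolding k_eq power_int_of_nat by simp
  moreover have "1 - q * q ^ n \<noteq> 0"
    using nome_power_neq_1[OF assms, of "Suc n"] by simp
  ultimately show ?thesis
    unfolding k_eq
    by (simp add: inv_qfact_of_nat qpoch_Suc del: of_nat_Suc) (simp add: inv_qfact_of_nat)
qed

lemma inv_qfact_tendsto:
  assumes "nome q"
  shows "(\<lambda>n. inv_qfact q (int n + k)) \<longlonglongrightarrow> 1 / euler_prod q"
proof -
  have "filterlim (\<lambda>n. nat (int n + k)) sequentially sequentially"
    unfolding filterlim_at_top
  proof
    fix Z
    show "eventually (\<lambda>n. Z \<le> nat (int n + k)) sequentially"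
      using eventually_ge_at_top[of "nat (int Z - k)"] by eventually_elim linarith
  qed
  hence "(\<lambda>n. qpoch q q (nat (int n + k))) \<longlonglongrightarrow> euler_prod q"
    by (rule filterlim_compose[OF qpoch_tendsto[OF nome_norm_less_1[OF assms]]])
  hence "(\<lambda>n. 1 / qpoch q q (nat (int n + k))) \<longlonglongrightarrow> 1 / euler_prod q"
    by (intro tendsto_divide tendsto_const euler_prod_nonzero assms)
  moreover have "eventually (\<lambda>n. 1 / qpoch q q (nat (int n + k)) =
      inv_qfact q (int n + k)) sequentially"
    using eventually_ge_at_top[of "nat (- k)"] by eventually_elim (simp add: inv_qfact_def)
  ultimately show ?thesis
    by (simp cong: tendsto_cong)
qed

lemma inv_qfact_bounded:
  assumes "nome q"
  obtains K where "K > 0" "\<And>k. norm (inv_qfact q k) \<le> K"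
proof -
  have "Bseq (\<lambda>n. inv_qfact q (int n))"
    using inv_qfact_tendsto[OF assms, of 0] by (intro convergent_imp_Bseq convergentI) simp
  then obtain K where bound: "K > 0" "\<And>n. norm (inv_qfact q (int n)) \<le> K"
    by (auto simp: Bseq_def)
  have "norm (inv_qfact q k) \<le> K" for k
    using bound(1) bound(2)[of "nat k"] by (cases "k < 0") auto
  with bound(1) that show ?thesis by blast
qed

section \<open>The q-binomial theorem and the Bailey chain\<close>

definition q_binomial_term :: "complex \<Rightarrow> complex \<Rightarrow> int \<Rightarrow> int \<Rightarrow> complex" where
  "q_binomial_term q z n k = theta_term q z k * (inv_qfact q k * inv_qfact q (n - k))"

lemma q_binomial_term_Pascal:
  assumes "nome q" "z \<noteq> 0"
  shows "(1 - q powi (n + 1)) * q_binomial_term q z (n + 1) k =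
    q_binomial_term q z n k + z * q powi n * q_binomial_term q z n (k - 1)"
proof -
  define x where "x = q powi (n + 1 - k)"
  have q_nonzero: "q \<noteq> 0"
    using assms(1) by (rule nome_nonzero)
  hence "q powi n = x * q powi (k - 1)"
    by (simp add: x_def flip: power_int_add)
  hence theta_shift: "z * q powi n * theta_term q z (k - 1) = x * theta_term q z k"
    using theta_term_add[OF q_nonzero assms(2), of "k - 1" 1] by simp
  have inv_qfact_shift: "inv_qfact q (n - k) = (1 - x) * inv_qfact q (n + 1 - k)"
    "inv_qfact q (k - 1) = (1 - q powi k) * inv_qfact q k"
    using inv_qfact_diff_1[OF assms(1), of "n + 1 - k"] inv_qfact_diff_1[OF assms(1), of k]
    by (simp_all add: x_def algebra_simps)
  have "z * q powi n * q_binomial_term q z n (k - 1) =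
      x * theta_term q z k * ((1 - q powi k) * inv_qfact q k * inv_qfact q (n + 1 - k))"
    unfolding theta_shift[symmetric] inv_qfact_shift[symmetric]
    by (simp add: q_binomial_term_def algebra_simps)
  hence "q_binomial_term q z n k + z * q powi n * q_binomial_term q z n (k - 1) =
      (1 - x + x * (1 - q powi k)) * q_binomial_term q z (n + 1) k"
    by (simp add: q_binomial_term_def inv_qfact_shift algebra_simps)
  moreover have "q powi (n + 1) = x * q powi k"
    using q_nonzero by (simp add: x_def flip: power_int_add)
  ultimately show ?thesis
    by (simp add: right_diff_distrib)
qed

theorem q_binomial_theorem:
  assumes "nome q" "z \<noteq> 0"
  shows "(q_binomial_term q z (int n) has_sum qpoch (- z) q n * inv_qfact q (int n)) UNIV"
proof (induction n)
  case 0
  show ?case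
    by (rule has_sum_finite_neutralI[of "{0}"]) (auto simp: q_binomial_term_def inv_qfact_def)
next
  case (Suc n)
  let ?c = "inv_qfact q"
  have int_Suc: "int (Suc n) = int n + 1" and power_int_Suc: "q powi (int n + 1) = q ^ Suc n"
    using power_int_of_nat[of q "Suc n"] by (simp_all add: add.commute)
  have inv_qfact_Suc: "?c (int n) = (1 - q ^ Suc n) * ?c (int (Suc n))"
    using inv_qfact_diff_1[OF assms(1), of "int n + 1"] unfolding int_Suc power_int_Suc by simp
  have "((\<lambda>k. q_binomial_term q z (int n) k +
        z * q ^ n * q_binomial_term q z (int n) (k - 1)) has_sum
      qpoch (- z) q n * ?c (int n) + z * q ^ n * (qpoch (- z) q n * ?c (int n))) UNIV"
    using Suc.IH has_sum_UNIV_translate[of "q_binomial_term q z (int n)" "- 1"]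
    by (intro has_sum_add has_sum_cmult_right) simp_all
  also have "(\<lambda>k. q_binomial_term q z (int n) k + z * q ^ n * q_binomial_term q z (int n) (k - 1)) =
      (\<lambda>k. (1 - q ^ Suc n) * q_binomial_term q z (int (Suc n)) k)"
    using q_binomial_term_Pascal[OF assms, of "int n"]
    by (simp only: int_Suc power_int_Suc power_int_of_nat)
  also have "qpoch (- z) q n * ?c (int n) + z * q ^ n * (qpoch (- z) q n * ?c (int n)) =
      (1 - q ^ Suc n) * (qpoch (- z) q (Suc n) * ?c (int (Suc n)))"
    unfolding inv_qfact_Suc qpoch_Suc by (simp add: algebra_simps)
  finally show ?case
    using nome_power_neq_1[OF assms(1), of "Suc n"] by (subst (asm) has_sum_cmult_right_iff) auto
qed

lemma qpoch_reverse:
  assumes "q \<noteq> 0" "z \<noteq> 0"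
  shows "qpoch (- (z / q ^ n)) q n = theta_term q (z / q ^ n) (int n) * qpoch (- (q / z)) q n"
proof (induction n)
  case (Suc n)
  have theta_Suc: "theta_term q (z / q ^ Suc n) (int (Suc n)) =
      z / q ^ Suc n * theta_term q (z / q ^ n) (int n)"
    using theta_term_add[of q "z / q ^ Suc n" 1 "int n"] assms by simp
  have "qpoch (- (z / q ^ Suc n)) q (1 + n) = (1 + z / q ^ Suc n) * qpoch (- (z / q ^ n)) q n"
    unfolding qpoch_add using assms by (simp add: qpoch_Suc)
  also have "\<dots> = (1 + z / q ^ Suc n) * theta_term q (z / q ^ n) (int n) * qpoch (- (q / z)) q n"
    by (simp add: Suc.IH)
  also have "\<dots> = theta_term q (z / q ^ Suc n) (int (Suc n)) * qpoch (- (q / z)) q (Suc n)"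
    unfolding theta_Suc qpoch_Suc using assms by (simp add: field_simps)
  finally show ?case
    by simp
qed simp

definition bailey_pair :: "complex \<Rightarrow> (int \<Rightarrow> complex) \<Rightarrow> (nat \<Rightarrow> complex) \<Rightarrow> bool" where
  "bailey_pair q \<alpha> \<beta> \<longleftrightarrow>
     (\<forall>n. ((\<lambda>r. \<alpha> r * (inv_qfact q (int n - r) * inv_qfact q (int n + r))) has_sum \<beta> n) UNIV)"

text \<open>
  This is the finite form of the Jacobi triple product. It is the q-binomial theorem for the
  exponent \<open>2n\<close> and the argument \<open>z / q\<^sup>n\<close>, with the summation index centred at \<open>n\<close>.
\<close>

lemma bailey_pair_theta_term:
  assumes "nome q" "z \<noteq> 0"
  shows "bailey_pair q (theta_term q z)
           (\<lambda>n. qpoch (- z) q n * qpoch (- (q / z)) q n * inv_qfact q (2 * int n))"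
  unfolding bailey_pair_def
proof
  fix n
  let ?c = "inv_qfact q" and ?C = "theta_term q (z / q ^ n) (int n)"
  have q_nonzero: "q \<noteq> 0"
    using assms(1) by (rule nome_nonzero)
  have theta_shift: "theta_term q (z / q ^ n) (r + int n) = ?C * theta_term q z r" for r
    using theta_term_add[of q "z / q ^ n" "int n" r] q_nonzero assms(2) by (simp add: add.commute)
  define F where "F = q_binomial_term q (z / q ^ n) (int (n + n))"
  have "(F has_sum qpoch (- (z / q ^ n)) q (n + n) * ?c (int (n + n))) UNIV"
    unfolding F_def by (rule q_binomial_theorem) (use assms q_nonzero in auto)
  hence "((\<lambda>r. F (r + int n)) has_sum qpoch (- (z / q ^ n)) q (n + n) * ?c (int (n + n))) UNIV"
    by (simp only: has_sum_UNIV_translate)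
  also have "qpoch (- (z / q ^ n)) q (n + n) = ?C * (qpoch (- z) q n * qpoch (- (q / z)) q n)"
    unfolding qpoch_add qpoch_reverse[OF q_nonzero assms(2)] using q_nonzero by simp
  also have "(\<lambda>r. F (r + int n)) =
      (\<lambda>r. ?C * (theta_term q z r * (?c (int n - r) * ?c (int n + r))))"
    unfolding F_def q_binomial_term_def theta_shift by (simp add: algebra_simps)
  finally show "((\<lambda>r. theta_term q z r * (?c (int n - r) * ?c (int n + r))) has_sum
      qpoch (- z) q n * qpoch (- (q / z)) q n * ?c (2 * int n)) UNIV"
    using q_nonzero assms(2) unfolding mult.assoc
    by (subst (asm) has_sum_cmult_right_iff) (auto simp: theta_term_def)
qed

text \<open>
  The summand of the q-Vandermonde identity in the limit where one of its upper parameters tends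
  to infinity.
\<close>

definition q_Vandermonde_term :: "complex \<Rightarrow> int \<Rightarrow> int \<Rightarrow> int \<Rightarrow> complex" where
  "q_Vandermonde_term q n m k =
     q powi (k * (k + m)) * (inv_qfact q (n - k) * (inv_qfact q k * inv_qfact q (k + m)))"

lemma q_Vandermonde_term_Suc_telescope:
  fixes n m k :: int
  assumes "nome q"
  defines "f \<equiv> \<lambda>k. q powi (k + (m + 1)) * q_Vandermonde_term q n (m + 1) k"
  shows "(1 - q powi (n + 1)) * q_Vandermonde_term q (n + 1) m k =
    f (k - 1) - f k + q_Vandermonde_term q n (m + 1) k"
proof -
  define V where "V = q_Vandermonde_term q (n + 1) m k"
  have q_nonzero: "q \<noteq> 0"
    using assms(1) by (rule nome_nonzero)
  have "q powi (k + m) * q powi ((k - 1) * (k + m)) = q powi (k * (k + m))"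
    using q_nonzero by (simp add: algebra_simps flip: power_int_add)
  hence "f (k - 1) = (1 - q powi k) * V"
    using inv_qfact_diff_1[OF assms(1), of k]
    by (simp add: V_def f_def q_Vandermonde_term_def mult_ac diff_diff_eq2)
  moreover have "q_Vandermonde_term q n (m + 1) k - f k = q powi k * (1 - q powi (n + 1 - k)) * V"
  proof -
    have "q powi (k * (k + (m + 1))) = q powi k * q powi (k * (k + m))"
      using q_nonzero by (simp add: algebra_simps flip: power_int_add)
    moreover have "inv_qfact q (n - k) = (1 - q powi (n + 1 - k)) * inv_qfact q (n + 1 - k)"
      using inv_qfact_diff_1[OF assms(1), of "n + 1 - k"] by (simp add: algebra_simps)
    moreover have "inv_qfact q (k + m) = (1 - q powi (k + m + 1)) * inv_qfact q (k + m + 1)"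
      using inv_qfact_diff_1[OF assms(1), of "k + m + 1"] by simp
    ultimately show ?thesis
      unfolding V_def f_def q_Vandermonde_term_def by (simp add: add_ac) (simp add: algebra_simps)
  qed
  moreover have "q powi (n + 1) = q powi k * q powi (n + 1 - k)"
    using q_nonzero by (simp flip: power_int_add)
  ultimately show ?thesis
    by (simp add: V_def algebra_simps)
qed

lemma has_sum_q_Vandermonde_term:
  assumes "nome q"
  shows "(q_Vandermonde_term q (int n) m has_sum
      inv_qfact q (int n) * inv_qfact q (int n + m)) UNIV"
proof (induction n arbitrary: m)
  case 0
  show ?case
    by (rule has_sum_finite_neutralI[of "{0}"]) (auto simp: q_Vandermonde_term_def inv_qfact_def)
next
  case (Suc n)
  let ?V = "q_Vandermonde_term q" and ?c = "inv_qfact q"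
  define f where "f = (\<lambda>k. q powi (k + (m + 1)) * ?V (int n) (m + 1) k)"
  have "{k. f k \<noteq> 0} \<subseteq> {0..int n}"
    by (auto simp: f_def q_Vandermonde_term_def inv_qfact_def split: if_splits)
  hence "f summable_on UNIV"
    by (intro finite_nonzero_values_imp_summable_on) (auto intro: finite_subset)
  then obtain S where has_sum_f: "(f has_sum S) UNIV"
    by (auto simp: summable_on_def)
  hence "((\<lambda>k. f (k - 1)) has_sum S) UNIV"
    using has_sum_UNIV_translate[of f "- 1"] by simp
  hence "((\<lambda>k. f (k - 1) + - f k + ?V (int n) (m + 1) k) has_sum
      S + - S + ?c (int n) * ?c (int n + (m + 1))) UNIV"
    by (intro has_sum_add has_sum_uminusI has_sum_f Suc.IH)
  also have "(\<lambda>k. f (k - 1) + - f k + ?V (int n) (m + 1) k) =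
      (\<lambda>k. (1 - q powi (int n + 1)) * ?V (int n + 1) m k)"
    unfolding q_Vandermonde_term_Suc_telescope[OF assms] f_def by simp
  also have "S + - S + ?c (int n) * ?c (int n + (m + 1)) =
      (1 - q powi (int n + 1)) * (?c (int n + 1) * ?c (int n + 1 + m))"
    using inv_qfact_diff_1[OF assms, of "int n + 1"] by (simp add: add_ac)
  finally show ?case
    using nome_power_neq_1[OF assms, of "Suc n"] power_int_of_nat[of q "Suc n"]
    by (subst (asm) has_sum_cmult_right_iff) (auto simp: add.commute)
qed

lemma has_sum_q_Vandermonde_centred:
  assumes "nome q"
  shows "((\<lambda>s. q powi (s * s) * inv_qfact q (n - s) * (inv_qfact q (s - r) * inv_qfact q (s + r)))
           has_sum q powi (r * r) * (inv_qfact q (n - r) * inv_qfact q (n + r))) UNIV"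
proof -
  define V where "V = q_Vandermonde_term q (n - r) (2 * r)"
  have "(V has_sum inv_qfact q (n - r) * inv_qfact q (n + r)) UNIV"
  proof (cases "n \<ge> r")
    case True
    thus ?thesis
      using has_sum_q_Vandermonde_term[OF assms, of "nat (n - r)" "2 * r"]
      by (simp add: V_def add.commute)
  next
    case False
    hence "V k = 0" for k
      by (cases "k < 0") (auto simp: V_def q_Vandermonde_term_def)
    with False show ?thesis
      by (auto intro: has_sum_0)
  qed
  hence "((\<lambda>s. q powi (r * r) * V (s + - r)) has_sum
      q powi (r * r) * (inv_qfact q (n - r) * inv_qfact q (n + r))) UNIV"
    by (intro has_sum_cmult_right) (simp only: has_sum_UNIV_translate)
  moreover have "q powi (r * r) * q powi ((s - r) * (s + r)) = q powi (s * s)" for s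
    using nome_nonzero[OF assms] by (simp add: algebra_simps flip: power_int_add)
  ultimately show ?thesis
    by (simp add: V_def q_Vandermonde_term_def add.commute flip: mult.assoc)
qed

lemma sum_q_Vandermonde_centred:
  assumes "nome q"
  shows "(\<Sum>s\<le>n. q ^ (s ^ 2) * inv_qfact q (int n - int s) *
      (inv_qfact q (int s - r) * inv_qfact q (int s + r))) =
    q powi (r * r) * (inv_qfact q (int n - r) * inv_qfact q (int n + r))"
proof -
  let ?h = "\<lambda>s. q powi (s * s) * inv_qfact q (int n - s) *
    (inv_qfact q (s - r) * inv_qfact q (s + r))"
  have "(?h has_sum (\<Sum>s\<in>{0..int n}. ?h s)) UNIV"
  proof (rule has_sum_finite_neutralI)
    fix s assume "s \<in> UNIV - {0..int n}"
    hence "int n - s < 0 \<or> s - r < 0 \<or> s + r < 0" by auto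
    thus "?h s = 0" by auto
  qed auto
  hence "(\<Sum>s\<in>{0..int n}. ?h s) =
      q powi (r * r) * (inv_qfact q (int n - r) * inv_qfact q (int n + r))"
    using has_sum_q_Vandermonde_centred[OF assms] by (rule has_sum_unique)
  moreover have "(\<Sum>s\<in>{0..int n}. ?h s) = (\<Sum>s\<le>n. ?h (int s))"
    by (rule sum.reindex_bij_witness[of _ int nat]) auto
  ultimately show ?thesis
    by (simp add: power2_eq_square flip: power_int_of_nat)
qed

theorem bailey_step:
  assumes "nome q" "bailey_pair q \<alpha> \<beta>"
  shows "bailey_pair q (\<lambda>r. q powi (r * r) * \<alpha> r)
           (\<lambda>n. \<Sum>s\<le>n. q ^ (s ^ 2) * \<beta> s * inv_qfact q (int n - int s))"
  unfolding bailey_pair_def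
proof
  fix n
  let ?c = "\<lambda>n r. inv_qfact q (n - r) * inv_qfact q (n + r)"
  define w where "w = (\<lambda>s. q ^ (s ^ 2) * inv_qfact q (int n - int s))"
  have "((\<lambda>r. \<Sum>s\<le>n. w s * (\<alpha> r * ?c (int s) r)) has_sum (\<Sum>s\<le>n. w s * \<beta> s)) UNIV"
    using assms(2) unfolding bailey_pair_def by (intro has_sum_sum has_sum_cmult_right) auto
  also have "(\<lambda>r. \<Sum>s\<le>n. w s * (\<alpha> r * ?c (int s) r)) = (\<lambda>r. \<alpha> r * (\<Sum>s\<le>n. w s * ?c (int s) r))"
    by (simp add: sum_distrib_left mult_ac)
  also have "\<dots> = (\<lambda>r. q powi (r * r) * \<alpha> r * ?c (int n) r)"
    unfolding w_def sum_q_Vandermonde_centred[OF assms(1)] by (simp add: mult_ac)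
  finally show "((\<lambda>r. q powi (r * r) * \<alpha> r * ?c (int n) r) has_sum
      (\<Sum>s\<le>n. q ^ (s ^ 2) * \<beta> s * inv_qfact q (int n - int s))) UNIV"
    by (simp add: w_def mult_ac)
qed

lemma bailey_pair_tendsto:
  assumes "nome q" "bailey_pair q \<alpha> \<beta>" "\<alpha> summable_on UNIV"
  shows "\<beta> \<longlonglongrightarrow> infsum \<alpha> UNIV / euler_prod q ^ 2"
proof -
  obtain K where bound: "K > 0" "\<And>k. norm (inv_qfact q k) \<le> K"
    using inv_qfact_bounded[OF assms(1)] by blast
  have "(\<lambda>n. infsum (\<lambda>r. \<alpha> r * (inv_qfact q (int n - r) * inv_qfact q (int n + r))) UNIV) \<longlonglongrightarrow>
          infsum (\<lambda>r. \<alpha> r * (1 / euler_prod q * (1 / euler_prod q))) UNIV"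
  proof (rule infsum_dominated_convergence)
    fix r
    show "(\<lambda>n. \<alpha> r * (inv_qfact q (int n - r) * inv_qfact q (int n + r))) \<longlonglongrightarrow>
            \<alpha> r * (1 / euler_prod q * (1 / euler_prod q))"
      using inv_qfact_tendsto[OF assms(1), of "- r"] inv_qfact_tendsto[OF assms(1), of r]
      by (intro tendsto_mult tendsto_const) auto
    fix n :: nat
    show "norm (\<alpha> r * (inv_qfact q (int n - r) * inv_qfact q (int n + r))) \<le> norm (\<alpha> r) * (K * K)"
      unfolding norm_mult using bound by (intro mult_left_mono mult_mono) auto
  next
    show "(\<lambda>r. norm (\<alpha> r) * (K * K)) summable_on UNIV"
      using assms(3)
      by (intro summable_on_cmult_left) (simp add: summable_on_iff_abs_summable_on_complex)
  qed
  moreover have "infsum (\<lambda>r. \<alpha> r * (inv_qfact q (int n - r) * inv_qfact q (int n + r))) UNIV =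
      \<beta> n" for n
    using assms(2) by (auto simp: bailey_pair_def intro: infsumI)
  ultimately show ?thesis
    unfolding infsum_cmult_left' by (simp add: power2_eq_square)
qed

lemma inv_qfact_convolution_tendsto:
  fixes \<gamma> :: "nat \<Rightarrow> complex"
  assumes "nome q" "summable (\<lambda>s. norm (\<gamma> s))"
  shows "(\<lambda>n. \<Sum>s\<le>n. \<gamma> s * inv_qfact q (int n - int s)) \<longlonglongrightarrow> suminf \<gamma> / euler_prod q"
proof -
  obtain K where bound: "K > 0" "\<And>k. norm (inv_qfact q k) \<le> K"
    using inv_qfact_bounded[OF assms(1)] by blast
  have "(\<lambda>n. infsum (\<lambda>s. \<gamma> s * inv_qfact q (int n - int s)) UNIV) \<longlonglongrightarrow>
          infsum (\<lambda>s. \<gamma> s * (1 / euler_prod q)) UNIV"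
  proof (rule infsum_dominated_convergence)
    fix s
    show "(\<lambda>n. \<gamma> s * inv_qfact q (int n - int s)) \<longlonglongrightarrow> \<gamma> s * (1 / euler_prod q)"
      using inv_qfact_tendsto[OF assms(1), of "- int s"] by (intro tendsto_mult tendsto_const) auto
    fix n :: nat
    show "norm (\<gamma> s * inv_qfact q (int n - int s)) \<le> norm (\<gamma> s) * K"
      unfolding norm_mult using bound by (intro mult_left_mono) auto
  next
    show "(\<lambda>s. norm (\<gamma> s) * K) summable_on UNIV"
      using assms(2) by (intro summable_on_cmult_left) (simp add: summable_on_UNIV_nonneg_real_iff)
  qed
  moreover have "infsum (\<lambda>s. \<gamma> s * inv_qfact q (int n - int s)) UNIV =
      (\<Sum>s\<le>n. \<gamma> s * inv_qfact q (int n - int s))" for n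
    by (rule infsumI, rule has_sum_finite_neutralI) (auto simp: not_le)
  moreover have "infsum \<gamma> UNIV = suminf \<gamma>"
    by (intro infsumI norm_summable_imp_has_sum assms summable_sums summable_norm_cancel)
  ultimately show ?thesis
    unfolding infsum_cmult_left' by simp
qed

theorem bailey_lemma_limit:
  assumes "nome q" "bailey_pair q \<alpha> \<beta>" "\<And>n. norm (\<beta> n) \<le> K"
    and "(\<lambda>r. q powi (r * r) * \<alpha> r) summable_on UNIV"
  shows "euler_prod q * (\<Sum>s. q ^ (s ^ 2) * \<beta> s) = infsum (\<lambda>r. q powi (r * r) * \<alpha> r) UNIV"
proof -
  have "summable (\<lambda>s. norm (q ^ (s ^ 2) * \<beta> s))"
  proof (rule summable_comparison_test)
    have norm_q: "norm q < 1"
      using assms(1) by (rule nome_norm_less_1)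
    thus "summable (\<lambda>s. norm q ^ s * K)"
      by (intro summable_mult2 summable_geometric) auto
    have "norm q ^ (s ^ 2) \<le> norm q ^ s" for s
      using norm_q by (intro power_decreasing) (auto simp: power2_eq_square)
    thus "\<exists>N. \<forall>s\<ge>N. norm (norm (q ^ (s ^ 2) * \<beta> s)) \<le> norm q ^ s * K"
      using assms(3) by (auto simp: norm_mult norm_power intro!: mult_mono)
  qed
  hence "(\<lambda>n. \<Sum>s\<le>n. q ^ (s ^ 2) * \<beta> s * inv_qfact q (int n - int s)) \<longlonglongrightarrow>
      (\<Sum>s. q ^ (s ^ 2) * \<beta> s) / euler_prod q"
    by (rule inv_qfact_convolution_tendsto[OF assms(1)])
  moreover have "(\<lambda>n. \<Sum>s\<le>n. q ^ (s ^ 2) * \<beta> s * inv_qfact q (int n - int s)) \<longlonglongrightarrow>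
      infsum (\<lambda>r. q powi (r * r) * \<alpha> r) UNIV / euler_prod q ^ 2"
    by (intro bailey_pair_tendsto bailey_step assms)
  ultimately have "(\<Sum>s. q ^ (s ^ 2) * \<beta> s) / euler_prod q =
      infsum (\<lambda>r. q powi (r * r) * \<alpha> r) UNIV / euler_prod q ^ 2"
    by (rule LIMSEQ_unique)
  thus ?thesis
    using euler_prod_nonzero[OF assms(1)] by (simp add: field_simps power2_eq_square)
qed

section \<open>The Jacobi triple product and the Rogers--Ramanujan identities\<close>

theorem Jacobi_triple_product:
  assumes "nome q" "z \<noteq> 0"
  shows "theta q z = qpoch_inf (- z) q * qpoch_inf (- (q / z)) q * euler_prod q"
proof -
  let ?\<beta> = "\<lambda>n. qpoch (- z) q n * qpoch (- (q / z)) q n * inv_qfact q (2 * int n)"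
  have "?\<beta> \<longlonglongrightarrow> theta q z / euler_prod q ^ 2"
    unfolding theta_def
    by (intro bailey_pair_tendsto bailey_pair_theta_term assms
        has_sum_imp_summable[OF has_sum_theta])
  moreover have "?\<beta> \<longlonglongrightarrow> qpoch_inf (- z) q * qpoch_inf (- (q / z)) q * (1 / euler_prod q)"
  proof (intro tendsto_mult qpoch_tendsto nome_norm_less_1 assms)
    have "filterlim (\<lambda>n. 2 * n) sequentially sequentially"
      by (rule filterlim_subseq) (auto simp: strict_mono_def)
    from filterlim_compose[OF inv_qfact_tendsto[OF assms(1), of 0] this]
    show "(\<lambda>n. inv_qfact q (2 * int n)) \<longlonglongrightarrow> 1 / euler_prod q" by simp
  qed
  ultimately have "theta q z / euler_prod q ^ 2 =
      qpoch_inf (- z) q * qpoch_inf (- (q / z)) q * (1 / euler_prod q)"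
    by (rule LIMSEQ_unique)
  thus ?thesis
    using euler_prod_nonzero[OF assms(1)] by (simp add: field_simps power2_eq_square)
qed

lemma bailey_pair_neg_1:
  assumes "nome q"
  shows "bailey_pair q (theta_term q (- 1)) (\<lambda>n. if n = 0 then 1 else 0)"
proof -
  have "qpoch 1 q n = 0" if "n > 0" for n
    using that by (intro qpoch_eq_0[of 0]) auto
  hence "qpoch (- (- 1)) q n * qpoch (- (q / - 1)) q n * inv_qfact q (2 * int n) =
      (if n = 0 then 1 else 0)" for n
    by auto
  thus ?thesis
    using bailey_pair_theta_term[OF assms, of "- 1"] by simp
qed

lemma bailey_pair_neg_q_squared:
  assumes "nome q"
  shows "bailey_pair q (theta_term q (- (q ^ 2)))
    (\<lambda>n. if n = 0 then 1 else if n = 1 then - (1 / q) else 0)"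
proof -
  have nonzero: "q \<noteq> 0" "1 - q \<noteq> 0" "1 - q ^ 2 \<noteq> 0"
    using nome_nonzero[OF assms] nome_power_neq_1[OF assms, of 1] nome_power_neq_1[OF assms, of 2]
    by auto
  have "qpoch (- (- (q ^ 2))) q n * qpoch (- (q / - (q ^ 2))) q n * inv_qfact q (2 * int n) =
      (if n = 0 then 1 else if n = 1 then - (1 / q) else 0)" for n
  proof -
    consider (zero) "n = 0" | (one) "n = 1" | (large) "n > 1" by linarith
    thus ?thesis
    proof cases
      case one
      have "inv_qfact q 2 = 1 / ((1 - q) * (1 - q ^ 2))"
        by (simp add: inv_qfact_def qpoch_def numeral_2_eq_2)
      hence "qpoch (q ^ 2) q 1 * qpoch (1 / q) q 1 * inv_qfact q 2 = (1 - 1 / q) / (1 - q)"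
        using nonzero(3) by (simp add: qpoch_def)
      also have "\<dots> = - (1 / q)"
        using nonzero by (simp add: divide_simps)
      finally show ?thesis
        using one nonzero by (simp add: power2_eq_square)
    next
      case large
      hence "qpoch (- (q / - (q ^ 2))) q n = 0"
        using nonzero by (intro qpoch_eq_0[of 1]) (auto simp: power2_eq_square)
      thus ?thesis using large by simp
    qed simp
  qed
  thus ?thesis
    using bailey_pair_theta_term[OF assms, of "- (q ^ 2)"] nonzero by simp
qed

lemma power_int_square_mult_theta_term:
  assumes "p \<noteq> 0"
  shows "p powi (r * r) * theta_term (p ^ a) z r = theta_term (p ^ (a + 2)) (p * z) r"
proof -
  have "int (a + 2) * tri r + r = r * r + int a * tri r"
    using two_mult_tri[of r] by (simp add: algebra_simps)
  hence "p powi (int (a + 2) * tri r) * p powi r = p powi (r * r) * p powi (int a * tri r)"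
    using assms by (simp only: power_int_add[symmetric] assms simp_thms)
  thus ?thesis
    unfolding theta_term_def power_int_mult_distrib power_int_power by (simp only: flip: mult.assoc)
qed

lemma rogers_ramanujan_theta:
  assumes "nome q" "z \<noteq> 0" "bailey_pair q (\<lambda>r. q powi (r * r) * theta_term q z r) \<beta>"
    and "\<And>n. norm (\<beta> n) \<le> K"
  shows "euler_prod q * (\<Sum>s. q ^ (s ^ 2) * \<beta> s) = theta (q ^ 5) (q ^ 2 * z)"
proof -
  have q_nonzero: "q \<noteq> 0"
    using assms(1) by (rule nome_nonzero)
  have theta_term_step: "q powi (r * r) * (q powi (r * r) * theta_term q z r) =
      theta_term (q ^ 5) (q ^ 2 * z) r" for r
    using power_int_square_mult_theta_term[OF q_nonzero, of r 1 z]
      power_int_square_mult_theta_term[OF q_nonzero, of r 3 "q * z"]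
    by (simp add: power2_eq_square power3_eq_cube mult.assoc)
  have "theta_term (q ^ 5) (q ^ 2 * z) summable_on UNIV"
    using q_nonzero assms by (intro has_sum_imp_summable[OF has_sum_theta] nome_power) auto
  thus ?thesis
    using bailey_lemma_limit[OF assms(1,3,4)] unfolding theta_term_step theta_def by simp
qed

theorem rogers_ramanujan_G:
  assumes "nome q"
  shows "euler_prod q * RR_G q = theta (q ^ 5) (- (q ^ 2))"
proof -
  obtain K where bound: "\<And>k. norm (inv_qfact q k) \<le> K"
    using inv_qfact_bounded[OF assms] by blast
  have "(\<Sum>s\<le>n. q ^ (s ^ 2) * (if s = 0 then 1 else 0) * inv_qfact q (int n - int s)) =
      inv_qfact q (int n)" for n
    by (simp add: if_distrib if_distribR cong: if_cong)
  hence "bailey_pair q (\<lambda>r. q powi (r * r) * theta_term q (- 1) r) (\<lambda>n. inv_qfact q (int n))"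
    using bailey_step[OF assms bailey_pair_neg_1[OF assms]] by simp
  hence "euler_prod q * (\<Sum>s. q ^ (s ^ 2) * inv_qfact q (int s)) = theta (q ^ 5) (q ^ 2 * - 1)"
    using bound by (intro rogers_ramanujan_theta assms) auto
  thus ?thesis
    by (simp add: RR_G_def inv_qfact_of_nat)
qed

text \<open>
  Starting the chain at \<open>z = - q\<^sup>2\<close> rather than \<open>z = - 1\<close> leaves just two nonzero terms \<open>1\<close> and
  \<open>- 1 / q\<close>, and their telescoping produces the additional factor \<open>q\<^sup>n\<close> of the second identity.
\<close>

theorem rogers_ramanujan_H:
  assumes "nome q"
  shows "euler_prod q * RR_H q = theta (q ^ 5) (- q)"
proof -
  let ?\<beta> = "\<lambda>n::nat. if n = 0 then 1 else if n = 1 then - (1 / q) else 0"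
  have nome: "q \<noteq> 0" "norm q < 1"
    using assms by (rule nomeD)+
  obtain K where bound: "\<And>k. norm (inv_qfact q k) \<le> K"
    using inv_qfact_bounded[OF assms] by blast
  have "(\<Sum>s\<le>n. q ^ (s ^ 2) * ?\<beta> s * inv_qfact q (int n - int s)) =
      q ^ n * inv_qfact q (int n)" for n
  proof -
    have "(\<Sum>s\<le>n. q ^ (s ^ 2) * ?\<beta> s * inv_qfact q (int n - int s)) =
        (\<Sum>s\<in>{0, 1}. q ^ (s ^ 2) * ?\<beta> s * inv_qfact q (int n - int s))"
    proof (cases "n = 0")
      case False
      thus ?thesis by (intro sum.mono_neutral_right) auto
    qed simp
    also have "\<dots> = inv_qfact q (int n) - inv_qfact q (int n - 1)"
      using nome by simp
    also have "\<dots> = q ^ n * inv_qfact q (int n)"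
      unfolding inv_qfact_diff_1[OF assms] by (simp add: algebra_simps)
    finally show ?thesis .
  qed
  hence "bailey_pair q (\<lambda>r. q powi (r * r) * theta_term q (- (q ^ 2)) r)
      (\<lambda>n. q ^ n * inv_qfact q (int n))"
    using bailey_step[OF assms bailey_pair_neg_q_squared[OF assms]] by simp
  moreover have "norm (q ^ n * inv_qfact q (int n)) \<le> 1 * K" for n
    unfolding norm_mult norm_power using bound nome by (intro mult_mono power_le_one) auto
  ultimately have "euler_prod q * (\<Sum>s. q ^ (s ^ 2) * (q ^ s * inv_qfact q (int s))) =
      theta (q ^ 5) (q ^ 2 * - (q ^ 2))"
    using nome by (intro rogers_ramanujan_theta assms) auto
  also have "q ^ 2 * - (q ^ 2) = q ^ 5 / - q"
    using nome by (simp add: field_simps eval_nat_numeral)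
  also have "theta (q ^ 5) (q ^ 5 / - q) = theta (q ^ 5) (- q)"
    using nome by (intro theta_reflect) auto
  finally show ?thesis
    by (simp add: RR_H_def inv_qfact_of_nat power_add power2_eq_square mult_ac)
qed

lemma euler_prod_power_5:
  assumes "nome q"
  shows "euler_prod (q ^ 5) = euler_prod q * RR_G q * RR_H q"
proof -
  have nome: "q \<noteq> 0" "norm q < 1" and nome_q5: "nome (q ^ 5)"
    using nomeD[OF assms] nome_power[OF assms] by auto
  have quotients: "q ^ 5 / q = q ^ 4" "q ^ 5 / q ^ 2 = q ^ 3"
    using nome by (simp_all add: field_simps eval_nat_numeral)
  have "(euler_prod q * RR_G q) * (euler_prod q * RR_H q) =
      qpoch_inf q (q ^ 5) * qpoch_inf (q ^ 2) (q ^ 5) * qpoch_inf (q ^ 3) (q ^ 5) *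
      qpoch_inf (q ^ 4) (q ^ 5) * qpoch_inf (q ^ 5) (q ^ 5) * euler_prod (q ^ 5)"
    unfolding rogers_ramanujan_G[OF assms] rogers_ramanujan_H[OF assms]
    using Jacobi_triple_product[OF nome_q5, of "- q"]
      Jacobi_triple_product[OF nome_q5, of "- (q ^ 2)"] nome
    by (simp add: quotients mult_ac)
  also have "qpoch_inf q (q ^ 5) * qpoch_inf (q ^ 2) (q ^ 5) * qpoch_inf (q ^ 3) (q ^ 5) *
      qpoch_inf (q ^ 4) (q ^ 5) * qpoch_inf (q ^ 5) (q ^ 5) = euler_prod q"
    by (subst qpoch_inf_dissect[OF nome(2), of 5 q]) (simp_all add: eval_nat_numeral)
  finally show ?thesis
    using euler_prod_nonzero[OF assms] by (simp add: mult_ac)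
qed

section \<open>The quintuple product identity\<close>

text \<open>
  After completing squares, both sides of the identity are sums over \<open>x\<^sup>2 + 3y\<^sup>2\<close>. Multiplication
  by a sixth root of unity matches the right-hand side with half of the terms on the left; the other
  half of the left-hand side cancels in pairs under another such rotation.
\<close>

definition quintuple_minuend :: "complex \<Rightarrow> complex \<Rightarrow> int \<times> int \<Rightarrow> complex" where
  "quintuple_minuend p w = (\<lambda>(n, m). p powi (tri n + 3 * tri m + 2 * m) * w powi (n - 3 * m))"

definition quintuple_subtrahend :: "complex \<Rightarrow> complex \<Rightarrow> int \<times> int \<Rightarrow> complex" where
  "quintuple_subtrahend p w =
     (\<lambda>(n, m). p powi (tri n + 3 * tri m + 2 * m) * w powi (n + 3 * m + 1))"

definition quintuple_difference :: "complex \<Rightarrow> complex \<Rightarrow> int \<times> int \<Rightarrow> complex" where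
  "quintuple_difference p w =
     (\<lambda>(a, b). (- 1) powi (a + b) * (p powi (tri a + 3 * tri b + b) * w powi (2 * a)))"

lemma has_sum_quintuple_minuend:
  assumes "nome p" "w \<noteq> 0"
  shows "(quintuple_minuend p w has_sum theta p w * theta (p ^ 3) (p ^ 2 / w ^ 3)) UNIV"
proof -
  have nome: "p \<noteq> 0" "nome (p ^ 3)"
    using assms nome_nonzero nome_power by auto
  have "quintuple_minuend p w = (\<lambda>(n, m). theta_term p w n * theta_term (p ^ 3) (p ^ 2 / w ^ 3) m)"
    using nome(1) assms(2)
    by (auto simp: quintuple_minuend_def theta_term_def power_int_add power_int_diff power_int_mult
        power_int_divide_distrib)
  thus ?thesis
    using has_sum_mult_Times[OF has_sum_theta[of p w] has_sum_theta[of "p ^ 3" "p ^ 2 / w ^ 3"]]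
      nome assms
    by simp
qed

lemma has_sum_quintuple_subtrahend:
  assumes "nome p" "w \<noteq> 0"
  shows "(quintuple_subtrahend p w has_sum theta p w * (w * theta (p ^ 3) (p ^ 2 * w ^ 3))) UNIV"
proof -
  have nome: "p \<noteq> 0" "nome (p ^ 3)"
    using assms nome_nonzero nome_power by auto
  have "quintuple_subtrahend p w =
     (\<lambda>(n, m). theta_term p w n * (w * theta_term (p ^ 3) (p ^ 2 * w ^ 3) m))"
    using nome(1) assms(2)
    by (auto simp: quintuple_subtrahend_def theta_term_def power_int_add power_int_mult
        power_int_mult_distrib)
  thus ?thesis
    using has_sum_mult_Times[OF has_sum_theta[of p w]
        has_sum_cmult_right[OF has_sum_theta[of "p ^ 3" "p ^ 2 * w ^ 3"], of w]] nome assms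
    by simp
qed

lemma has_sum_quintuple_difference:
  assumes "nome p" "w \<noteq> 0"
  shows "(quintuple_difference p w has_sum theta p (- (w ^ 2)) * theta (p ^ 3) (- p)) UNIV"
proof -
  have nome: "p \<noteq> 0" "nome (p ^ 3)"
    using assms nome_nonzero nome_power by auto
  have "quintuple_difference p w =
      (\<lambda>(a, b). theta_term p (- (w ^ 2)) a * theta_term (p ^ 3) (- p) b)"
    using nome(1) assms(2)
    by (auto simp: quintuple_difference_def theta_term_def power_int_add power_int_mult
        power_int_minus_left)
  thus ?thesis
    using has_sum_mult_Times[OF has_sum_theta[of p "- (w ^ 2)"] has_sum_theta[of "p ^ 3" "- p"]]
      nome assms
    by simp
qed

lemma infsum_quintuple_minuend_even:
  "infsum (quintuple_minuend p w) {x. even (fst x + snd x)} =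
   infsum (quintuple_difference p w) {x. even (fst x + snd x)}"
proof -
  have exponent: "tri (2 * b - m) + 3 * tri m + 2 * m = tri (b - 2 * m) + 3 * tri b + b" for b m
    using two_mult_tri[of "2 * b - m"] two_mult_tri[of m] two_mult_tri[of "b - 2 * m"]
      two_mult_tri[of b]
    by (simp add: algebra_simps)
  have "infsum (quintuple_minuend p w) {x. even (fst x + snd x)} =
      infsum (\<lambda>(b, m). quintuple_minuend p w (2 * b - m, m)) UNIV"
    by (rule infsum_reindex_bij_witness[of _
          "\<lambda>(b, m). (2 * b - m, m)" "\<lambda>(n, m). ((n + m) div 2, m)"]) auto
  also have "\<dots> = infsum (\<lambda>(b, m). quintuple_difference p w (b - 2 * m, b)) UNIV"
    by (simp add: quintuple_minuend_def quintuple_difference_def exponent)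
  also have "\<dots> = infsum (quintuple_difference p w) {x. even (fst x + snd x)}"
    by (rule infsum_reindex_bij_witness[of _
          "\<lambda>(a, b). (b, (b - a) div 2)" "\<lambda>(b, m). (b - 2 * m, b)"]) auto
  finally show ?thesis .
qed

lemma infsum_quintuple_subtrahend_odd:
  "infsum (quintuple_subtrahend p w) {x. odd (fst x + snd x)} =
   - infsum (quintuple_difference p w) {x. odd (fst x + snd x)}"
proof -
  have exponent: "tri (m + 1 - 2 * b) + 3 * tri m + 2 * m = tri (2 * m + 1 - b) + 3 * tri b + b"
    "m + 1 - 2 * b + 3 * m + 1 = 2 * (2 * m + 1 - b)" for b m
    using two_mult_tri[of "m + 1 - 2 * b"] two_mult_tri[of m] two_mult_tri[of "2 * m + 1 - b"]
      two_mult_tri[of b]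
    by (simp_all add: algebra_simps)
  have "infsum (quintuple_subtrahend p w) {x. odd (fst x + snd x)} =
      infsum (\<lambda>(b, m). quintuple_subtrahend p w (m + 1 - 2 * b, m)) UNIV"
    by (rule infsum_reindex_bij_witness[of _
          "\<lambda>(b, m). (m + 1 - 2 * b, m)" "\<lambda>(n, m). ((m + 1 - n) div 2, m)"])
       (auto elim!: oddE simp: add.commute)
  also have "\<dots> = infsum (\<lambda>(b, m). - quintuple_difference p w (2 * m + 1 - b, b)) UNIV"
    unfolding quintuple_subtrahend_def quintuple_difference_def prod.case exponent by simp
  also have "\<dots> = infsum (\<lambda>x. - quintuple_difference p w x) {x. odd (fst x + snd x)}"
    by (rule infsum_reindex_bij_witness[of _
          "\<lambda>(a, b). (b, (a + b - 1) div 2)" "\<lambda>(b, m). (2 * m + 1 - b, b)"]) auto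
  finally show ?thesis
    by (simp add: infsum_uminus)
qed

lemma infsum_quintuple_minuend_odd:
  "infsum (quintuple_minuend p w) {x. odd (fst x + snd x)} =
   infsum (quintuple_subtrahend p w) {x. even (fst x + snd x)}"
proof -
  have exponent: "tri (1 + 2 * m + k) + 3 * tri k + 2 * k = tri (- 2 * k - m) + 3 * tri m + 2 * m"
    "1 + 2 * m + k - 3 * k = - 2 * k - m + 3 * m + 1" for k m
    using two_mult_tri[of "1 + 2 * m + k"] two_mult_tri[of k] two_mult_tri[of "- 2 * k - m"]
      two_mult_tri[of m]
    by (simp_all add: algebra_simps)
  have "infsum (quintuple_minuend p w) {x. odd (fst x + snd x)} =
      infsum (\<lambda>(k, m). quintuple_minuend p w (1 + 2 * m + k, k)) UNIV"
    by (rule infsum_reindex_bij_witness[of _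
          "\<lambda>(k, m). (1 + 2 * m + k, k)" "\<lambda>(n, k). (k, (n - 1 - k) div 2)"]) auto
  also have "\<dots> = infsum (\<lambda>(k, m). quintuple_subtrahend p w (- 2 * k - m, m)) UNIV"
    unfolding quintuple_minuend_def quintuple_subtrahend_def prod.case exponent ..
  also have "\<dots> = infsum (quintuple_subtrahend p w) {x. even (fst x + snd x)}"
    by (rule infsum_reindex_bij_witness[of _
          "\<lambda>(n, m). ((- n - m) div 2, m)" "\<lambda>(k, m). (- 2 * k - m, m)"]) auto
  finally show ?thesis .
qed

theorem quintuple_product:
  assumes "nome p" "w \<noteq> 0"
  shows "theta p w * (theta (p ^ 3) (p ^ 2 / w ^ 3) - w * theta (p ^ 3) (p ^ 2 * w ^ 3)) =
         theta p (- (w ^ 2)) * theta (p ^ 3) (- p)"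
proof -
  note sums = has_sum_quintuple_minuend[OF assms] has_sum_quintuple_subtrahend[OF assms]
    has_sum_quintuple_difference[OF assms]
  have "infsum (quintuple_minuend p w) UNIV - infsum (quintuple_subtrahend p w) UNIV =
      infsum (quintuple_difference p w) UNIV"
    unfolding
      sums[THEN has_sum_imp_summable, THEN infsum_split_Collect[of _ "\<lambda>x. even (fst x + snd x)"]]
      infsum_quintuple_minuend_even infsum_quintuple_minuend_odd infsum_quintuple_subtrahend_odd
    by simp
  thus ?thesis
    unfolding sums[THEN infsumI] by (simp add: right_diff_distrib)
qed

section \<open>The 5-dissection of Euler's product\<close>

definition pentagonal :: "int \<Rightarrow> nat" where
  "pentagonal n = nat (n * (3 * n - 1) div 2)"

lemma int_pentagonal: "int (pentagonal n) = 3 * tri n + n"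
proof -
  have "n * (3 * n - 1) = 2 * (3 * tri n + n)"
    using two_mult_tri[of n] by (simp add: algebra_simps)
  moreover have "0 \<le> n * (3 * n - 1)"
    by (cases "n \<le> 0") (auto intro: mult_nonpos_nonpos)
  ultimately show ?thesis
    by (simp add: pentagonal_def)
qed

definition pent_term :: "complex \<Rightarrow> int \<Rightarrow> complex" where
  "pent_term q n = (- 1) powi n * q ^ pentagonal n"

lemma pent_term_eq_theta_term:
  assumes "q \<noteq> 0"
  shows "pent_term q = theta_term (q ^ 3) (- q)"
proof
  fix n
  have "q ^ pentagonal n = q powi (3 * tri n + n)"
    unfolding int_pentagonal[symmetric] by simp
  also have "\<dots> = (q ^ 3) powi tri n * q powi n"
    using assms by (simp add: power_int_add power_int_mult)
  finally show "pent_term q n = theta_term (q ^ 3) (- q) n"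
    by (cases "even n") (simp_all add: pent_term_def theta_term_def)
qed

lemma theta_cube_eq_euler_prod:
  assumes "nome q"
  shows "theta (q ^ 3) (- q) = euler_prod q"
proof -
  have nome: "q \<noteq> 0" "norm q < 1" "nome (q ^ 3)"
    using nomeD[OF assms] nome_power[OF assms] by auto
  have "q ^ 3 / q = q ^ 2"
    using nome by (simp add: field_simps eval_nat_numeral)
  hence "theta (q ^ 3) (- q) =
      qpoch_inf q (q ^ 3) * qpoch_inf (q ^ 2) (q ^ 3) * qpoch_inf (q ^ 3) (q ^ 3)"
    using Jacobi_triple_product[OF nome(3), of "- q"] nome by simp
  also have "\<dots> = euler_prod q"
    by (subst qpoch_inf_dissect[OF nome(2), of 3 q]) (simp_all add: eval_nat_numeral)
  finally show ?thesis .
qed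

theorem pentagonal_number_theorem:
  assumes "nome q"
  shows "(pent_term q has_sum euler_prod q) UNIV"
  unfolding pent_term_eq_theta_term[OF nome_nonzero[OF assms]]
    theta_cube_eq_euler_prod[OF assms, symmetric]
  using assms by (intro has_sum_theta nome_power) (auto dest: nome_nonzero)

lemma has_sum_pent_term_residue_class:
  assumes "nome q"
  shows "(pent_term q has_sum pent_term q j * theta ((q ^ 5) ^ 15) (- ((q ^ 5) powi (3 * j + 7))))
    {n. n mod 5 = j mod 5}"
proof -
  have nome: "q \<noteq> 0" "nome (q ^ 3)"
    using assms nome_nonzero nome_power by auto
  have "(q ^ 3) powi tri 5 * ((q ^ 3) powi j * (- q)) ^ 5 =
      - (q powi 30 * (q powi (15 * j) * q powi 5))"
    by (simp add: tri_def power_int_power power_int_power' power_mult_distrib mult_ac)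
  also have "\<dots> = - (q powi (5 * (3 * j + 7)))"
    using nome by (simp only: power_int_add[symmetric] simp_thms) (simp add: algebra_simps)
  finally have argument: "(q ^ 3) powi tri 5 * ((q ^ 3) powi j * (- q)) ^ 5 =
      - ((q ^ 5) powi (3 * j + 7))"
    by (simp only: power_int_mult power_int_numeral)
  have base: "(q ^ 3) ^ (5 * 5) = (q ^ 5) ^ 15"
    by (simp flip: power_mult)
  show ?thesis
    using has_sum_theta_term_residue_class[of "q ^ 3" "- q" 5 j] nome argument base
    by (simp add: pent_term_eq_theta_term)
qed

lemma quintuple_product_rogers_ramanujan:
  assumes "nome q" "w \<noteq> 0"
    and "theta (q ^ 5) w = euler_prod q * B" "theta (q ^ 5) (- (w ^ 2)) = euler_prod q * A"
    and "A * B = RR_G q * RR_H q"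
  shows "theta (q ^ 15) (q ^ 10 / w ^ 3) - w * theta (q ^ 15) (q ^ 10 * w ^ 3) =
      euler_prod q * A ^ 2"
proof -
  have nome_q5: "nome (q ^ 5)"
    using assms(1) by (rule nome_power) simp
  let ?Q = "theta (q ^ 15) (q ^ 10 / w ^ 3) - w * theta (q ^ 15) (q ^ 10 * w ^ 3)"
  have euler_prod_q5: "euler_prod (q ^ 5) = euler_prod q * (A * B)"
    unfolding assms(5) euler_prod_power_5[OF assms(1)] by simp
  have "theta (q ^ 15) (- (q ^ 5)) = euler_prod q * (A * B)"
    using theta_cube_eq_euler_prod[OF nome_q5] euler_prod_q5 by (simp flip: power_mult)
  hence "euler_prod q * B * ?Q = euler_prod q * A * (euler_prod q * (A * B))"
    using quintuple_product[OF nome_q5 assms(2)] by (simp add: assms(3,4) flip: power_mult)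
  hence "(euler_prod q * B) * ?Q = (euler_prod q * B) * (euler_prod q * A ^ 2)"
    by (simp add: power2_eq_square mult_ac)
  moreover have "euler_prod q * B \<noteq> 0"
    using euler_prod_nonzero[OF nome_q5] euler_prod_q5 by auto
  ultimately show ?thesis
    by (metis mult_left_cancel)
qed

lemma theta_sum_eq_RR_G_squared:
  assumes "nome q"
  shows "theta (q ^ 15) (- (q ^ 7)) + q * theta (q ^ 15) (- (q ^ 13)) = euler_prod q * RR_G q ^ 2"
proof -
  have q_nonzero: "q \<noteq> 0"
    using assms by (rule nome_nonzero)
  hence "q ^ 10 / (- q) ^ 3 = - (q ^ 7)" "q ^ 10 * (- q) ^ 3 = - (q ^ 13)"
    by (simp_all add: field_simps eval_nat_numeral)
  thus ?thesis
    using quintuple_product_rogers_ramanujan[OF assms, of "- q" "RR_H q" "RR_G q"] q_nonzero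
    by (simp add: rogers_ramanujan_G[OF assms] rogers_ramanujan_H[OF assms])
qed

lemma theta_sum_eq_RR_H_squared:
  assumes "nome q"
  shows "theta (q ^ 15) (- (q ^ 4)) + q ^ 2 * theta (q ^ 15) (- (q ^ 16)) =
      euler_prod q * RR_H q ^ 2"
proof -
  have q_nonzero: "q \<noteq> 0"
    using assms by (rule nome_nonzero)
  hence powers: "q ^ 10 / (- (q ^ 2)) ^ 3 = - (q ^ 4)" "q ^ 10 * (- (q ^ 2)) ^ 3 = - (q ^ 16)"
    "- ((- (q ^ 2)) ^ 2) = q ^ 5 / - q"
    by (simp_all add: field_simps eval_nat_numeral)
  have "theta (q ^ 5) (- ((- (q ^ 2)) ^ 2)) = euler_prod q * RR_H q"
    unfolding powers(3) rogers_ramanujan_H[OF assms] using q_nonzero by (intro theta_reflect) auto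
  thus ?thesis
    using quintuple_product_rogers_ramanujan[OF assms, of "- (q ^ 2)" "RR_G q" "RR_H q"]
      q_nonzero powers(1,2)
    by (simp add: rogers_ramanujan_G[OF assms])
qed

lemma theta_eq_RR_G_RR_H:
  assumes "nome q"
  shows "theta (q ^ 15) (- (q ^ 10)) = euler_prod q * RR_G q * RR_H q"
proof -
  have nome: "q \<noteq> 0" "nome (q ^ 5)"
    using assms nome_nonzero nome_power by auto
  have "theta (q ^ 15) (- (q ^ 10)) = theta (q ^ 15) (q ^ 15 / - (q ^ 10))"
    using nome by (intro theta_reflect[symmetric]) auto
  also have "q ^ 15 / - (q ^ 10) = - (q ^ 5)"
    using nome by (simp add: field_simps flip: power_add)
  also have "theta (q ^ 15) (- (q ^ 5)) = euler_prod (q ^ 5)"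
    using theta_cube_eq_euler_prod[OF nome(2)] by (simp flip: power_mult)
  finally show ?thesis
    by (simp only: euler_prod_power_5[OF assms])
qed

lemma pentagonal_mod_5:
  "pentagonal n mod 5 = (if n mod 5 = 0 \<or> n mod 5 = 2 then 0 else if n mod 5 = 1 then 1 else 2)"
proof -
  define j where "j = n mod 5"
  have "int (pentagonal n) = n * (2 - n) + 5 * (3 * tri n - n * (n - 1))"
    using two_mult_tri[of n] by (simp add: int_pentagonal algebra_simps)
  hence "int (pentagonal n) mod 5 = n * (2 - n) mod 5"
    by (simp only: mod_mult_self2)
  also have "\<dots> = j * (2 - j) mod 5"
    using cong_mult[of n j 5 "2 - n" "2 - j"] cong_diff[of 2 2 5 n j] by (simp add: cong_def j_def)
  finally have "int (pentagonal n mod 5) = j * (2 - j) mod 5"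
    by (simp add: zmod_int)
  moreover have "j = 0 \<or> j = 1 \<or> j = 2 \<or> j = 3 \<or> j = 4"
    unfolding j_def by presburger
  ultimately have "int (pentagonal n mod 5) = (if j = 0 \<or> j = 2 then 0 else if j = 1 then 1 else 2)"
    by (elim disjE) simp_all
  thus ?thesis
    unfolding j_def by (auto split: if_splits)
qed

abbreviation pent_class :: "nat \<Rightarrow> int set" where
  "pent_class k \<equiv> {n. pentagonal n mod 5 = k}"

lemma pent_class_eq:
  "pent_class 0 = {n. n mod 5 = 0 mod 5} \<union> {n. n mod 5 = 2 mod 5}"
  "pent_class 1 = {n. n mod 5 = 1 mod 5}"
  "pent_class 2 = {n. n mod 5 = - 1 mod 5} \<union> {n. n mod 5 = 3 mod 5}"
proof -
  show "pent_class 2 = {n. n mod 5 = - 1 mod 5} \<union> {n. n mod 5 = 3 mod 5}"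
    by (simp add: pentagonal_mod_5 set_eq_iff) presburger
qed (auto simp: pentagonal_mod_5 split: if_splits)

text \<open>
  The quotient \<open>RR_H5 q / RR_G5 q\<close> is the Rogers--Ramanujan continued fraction at \<open>q\<^sup>5\<close>, whose
  fractional power \<open>(q\<^sup>5)\<^bsup>1/5\<^esup>\<close> is thereby fixed as \<open>q\<close>.
\<close>

definition RR_G5 :: "complex \<Rightarrow> complex" where
  "RR_G5 q = RR_G (q ^ 5)"

definition RR_H5 :: "complex \<Rightarrow> complex" where
  "RR_H5 q = q * RR_H (q ^ 5)"

definition euler_part :: "complex \<Rightarrow> nat \<Rightarrow> complex" where
  "euler_part q k = euler_prod (q ^ 5) *
     (if k = 0 then RR_G5 q ^ 2 else if k = 1 then - (RR_G5 q * RR_H5 q) else - (RR_H5 q ^ 2))"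

theorem has_sum_pent_term_pent_class:
  assumes "nome q" "k < 3"
  shows "(pent_term q has_sum euler_part q k) (pent_class k)"
proof -
  have nome_q5: "nome (q ^ 5)"
    using assms(1) by (rule nome_power) simp
  have pent_term_values: "pent_term q 0 = 1" "pent_term q 1 = - q" "pent_term q 2 = q ^ 5"
    "pent_term q (- 1) = - (q ^ 2)" "pent_term q 3 = - (q ^ 2 * (q ^ 5) ^ 2)"
    by (simp_all add: pent_term_def pentagonal_def flip: power_mult power_add)
  note residue_class = has_sum_pent_term_residue_class[OF assms(1)]
  consider (zero) "k = 0" | (one) "k = 1" | (two) "k = 2" using assms(2) by linarith
  thus ?thesis
  proof cases
    case zero
    have "(pent_term q has_sum euler_part q 0) (pent_class 0)"
      using has_sum_Un_disjoint[OF residue_class[of 0] residue_class[of 2]]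
        theta_sum_eq_RR_G_squared[OF nome_q5]
      unfolding pent_class_eq by (simp add: euler_part_def RR_G5_def pent_term_values disjoint_iff)
    with zero show ?thesis by simp
  next
    case one
    have "(pent_term q has_sum euler_part q 1) (pent_class 1)"
      using residue_class[of 1] theta_eq_RR_G_RR_H[OF nome_q5]
      unfolding pent_class_eq
      by (simp add: euler_part_def RR_G5_def RR_H5_def pent_term_values mult_ac)
    with one show ?thesis by simp
  next
    case two
    have "- (q ^ 2) * theta ((q ^ 5) ^ 15) (- ((q ^ 5) ^ 4)) -
        q ^ 2 * (q ^ 5) ^ 2 * theta ((q ^ 5) ^ 15) (- ((q ^ 5) ^ 16)) =
        - (q ^ 2) * (euler_prod (q ^ 5) * RR_H (q ^ 5) ^ 2)"
      unfolding theta_sum_eq_RR_H_squared[OF nome_q5, symmetric]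
      by (simp add: right_diff_distrib distrib_left)
    also have "\<dots> = euler_part q 2"
      by (simp add: euler_part_def RR_H5_def power_mult_distrib)
    finally have "(pent_term q has_sum euler_part q 2) (pent_class 2)"
      using has_sum_Un_disjoint[OF residue_class[of "- 1"] residue_class[of 3]]
      unfolding pent_class_eq by (simp add: pent_term_values disjoint_iff)
    with two show ?thesis by simp
  qed
qed

lemma euler_part_1:
  assumes "nome q"
  shows "euler_part q 1 = - (q * euler_prod (q ^ 25))"
  using euler_prod_power_5[OF nome_power[OF assms, of 5]]
  by (simp add: euler_part_def RR_G5_def RR_H5_def mult_ac flip: power_mult)

lemma RR_U_of_dvd_add:
  assumes "5 dvd r + s"
  shows "RR_U r s (q ^ 5) = RR_G5 (q ^ r) * RR_G5 (q ^ s) + RR_H5 (q ^ r) * RR_H5 (q ^ s)"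
proof -
  have "(q ^ 5) ^ ((s + r) div 5) = q ^ s * q ^ r"
    using assms by (simp add: add.commute flip: power_mult power_add)
  thus ?thesis
    using assms
    by (simp add: RR_U_def RR_G5_def RR_H5_def cong_0_iff add.commute mult_ac power_commutes
      flip: power_mult)
qed

lemma RR_U_of_mod_eq:
  assumes "r mod 5 = s mod 5" "\<not> 5 dvd r" "q \<noteq> 0"
  shows "q ^ r * RR_U r s (q ^ 5) = RR_H5 (q ^ r) * RR_G5 (q ^ s) - RR_G5 (q ^ r) * RR_H5 (q ^ s)"
proof -
  have "5 dvd int s - int r"
    using assms(1) by presburger
  moreover from this have "q ^ r * (q ^ 5) powi ((int s - int r) div 5) = q ^ s"
    using assms(3) by (simp add: power_int_power power_int_diff)
  moreover have "\<not> [s + r = 0] (mod 5)"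
    using assms(1,2) unfolding cong_def by presburger
  ultimately show ?thesis
    by (simp add: RR_U_def RR_G5_def RR_H5_def cong_0_iff right_diff_distrib mult_ac
      flip: power_mult)
qed

section \<open>The Hecke operator on eta products\<close>

lemma q_pow_add: "q_pow \<tau> (a + b) = q_pow \<tau> a * q_pow \<tau> b"
  by (simp add: q_pow_def ring_distribs exp_add)

lemma q_pow_power: "q_pow \<tau> a ^ n = q_pow \<tau> (real n * a)"
  by (simp add: q_pow_def mult_ac flip: exp_of_nat_mult)

lemma q_pow_of_real_mult: "q_pow (of_real c * \<tau>) a = q_pow \<tau> (c * a)"
  by (simp add: q_pow_def mult_ac)

lemma nome_q_pow: "Im \<tau> > 0 \<Longrightarrow> a > 0 \<Longrightarrow> nome (q_pow \<tau> a)"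
  by (simp add: nome_def q_pow_def)

lemma hecke_T5_of_q_expansion:
  assumes "has_q_expansion f a" "Im \<tau> > 0" "(\<lambda>n. a (5 * n) * q_pow \<tau> 1 ^ n) sums S"
  shows "hecke_T5 f \<tau> = S + f (5 * \<tau>)"
proof -
  define q where "q = q_pow \<tau> 1"
  have "(\<lambda>n. a n * q_pow (5 * \<tau>) 1 ^ n) sums f (5 * \<tau>)"
    using assms unfolding has_q_expansion_def by simp
  moreover have "q_pow (5 * \<tau>) 1 = q ^ 5"
    using q_pow_of_real_mult[of 5 \<tau> 1] by (simp add: q_def q_pow_power)
  ultimately have "(\<lambda>n. (if 5 dvd 5 * n then a (5 * n div 5) else 0) * q ^ (5 * n)) sums f (5 * \<tau>)"
    by (simp add: power_mult)
  hence "(\<lambda>n. (if 5 dvd n then a (n div 5) else 0) * q ^ n) sums f (5 * \<tau>)"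
    by (subst (asm) sums_mono_reindex[of "\<lambda>n. 5 * n"]) (auto simp: strict_mono_def elim!: dvdE)
  with assms(3) have "(\<lambda>n. hecke_T5_coeff a n * q ^ n) sums (S + f (5 * \<tau>))"
    unfolding q_def hecke_T5_coeff_def ring_distribs by (rule sums_add)
  moreover have "(THE a. has_q_expansion f a) = a"
    using assms(1) by (blast intro: has_q_expansion_unique)
  ultimately show ?thesis
    by (simp add: hecke_T5_def q_def sums_iff)
qed

lemma hecke_T5_of_has_sum:
  assumes expansion: "\<And>t. Im t > 0 \<Longrightarrow> ((\<lambda>i. w i * q_pow t 1 ^ e i) has_sum f t) I" and "Im \<tau> > 0"
  shows "hecke_T5 f \<tau> = infsum (\<lambda>i. w i * q_pow \<tau> (1 / 5) ^ e i) {i \<in> I. 5 dvd e i} + f (5 * \<tau>)"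
proof (rule hecke_T5_of_q_expansion)
  show "has_q_expansion f (\<lambda>n. infsum w {i \<in> I. e i = n})"
    unfolding has_q_expansion_def using expansion by (blast intro: sums_infsum_fibres)
next
  let ?y = "q_pow \<tau> (1 / 5)" and ?J = "{i \<in> I. 5 dvd e i}"
  have fifth_root: "q_pow (of_real (1 / 5) * \<tau>) 1 = ?y" "?y ^ 5 = q_pow \<tau> 1"
    unfolding q_pow_of_real_mult by (simp_all add: q_pow_power)
  have "(\<lambda>i. w i * ?y ^ e i) summable_on I"
    using expansion[of "of_real (1 / 5) * \<tau>"] assms(2) unfolding fifth_root
    by (auto simp: summable_on_def)
  hence "(\<lambda>i. w i * ?y ^ e i) summable_on ?J"
    by (rule summable_on_subset_banach) auto
  hence "((\<lambda>i. w i * ?y ^ e i) has_sum infsum (\<lambda>i. w i * ?y ^ e i) ?J) ?J"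
    by (rule has_sum_infsum)
  also have "?this \<longleftrightarrow> ((\<lambda>i. w i * q_pow \<tau> 1 ^ (e i div 5)) has_sum
      infsum (\<lambda>i. w i * ?y ^ e i) ?J) ?J"
    by (rule has_sum_cong) (auto simp flip: fifth_root(2) power_mult)
  finally have "(\<lambda>n. infsum w {i \<in> ?J. e i div 5 = n} * q_pow \<tau> 1 ^ n) sums
      infsum (\<lambda>i. w i * ?y ^ e i) ?J"
    by (rule sums_infsum_fibres)
  moreover have "{i \<in> ?J. e i div 5 = n} = {i \<in> I. e i = 5 * n}" for n
    by auto
  ultimately show "(\<lambda>n. infsum w {i \<in> I. e i = 5 * n} * q_pow \<tau> 1 ^ n) sums
      infsum (\<lambda>i. w i * ?y ^ e i) ?J"
    by simp
qed fact

locale eta_pair =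
  fixes r s N :: nat
  assumes r_pos: "r > 0" and s_pos: "s > 0" and r_plus_s: "r + s = 24 * N"
begin

definition eta_product :: "complex \<Rightarrow> complex" where
  "eta_product \<tau> = dedekind_eta (of_nat r * \<tau>) * dedekind_eta (of_nat s * \<tau>)"

definition exponent :: "int \<times> int \<Rightarrow> nat" where
  "exponent = (\<lambda>(m, n). N + r * pentagonal m + s * pentagonal n)"

lemma real_r_plus_s: "real r + real s = 24 * real N"
  using r_plus_s by (metis of_nat_add of_nat_mult of_nat_numeral)

lemma eta_product_eq_euler_prod:
  "eta_product \<tau> = q_pow \<tau> N * (euler_prod (q_pow \<tau> 1 ^ r) * euler_prod (q_pow \<tau> 1 ^ s))"
proof -
  have "real N = real r * (1 / 24) + real s * (1 / 24)"
    using real_r_plus_s by simp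
  hence "q_pow \<tau> N = q_pow \<tau> (real r * (1 / 24)) * q_pow \<tau> (real s * (1 / 24))"
    by (simp only: q_pow_add)
  moreover have "q_pow (of_nat k * \<tau>) a = q_pow \<tau> (real k * a)" for k a
    using q_pow_of_real_mult[of "real k" \<tau> a] by simp
  ultimately show ?thesis
    by (simp add: eta_product_def dedekind_eta_def q_pow_power)
qed

lemma pent_term_mult_eq:
  "q ^ N * (pent_term (q ^ r) m * pent_term (q ^ s) n) =
      (- 1) powi m * (- 1) powi n * q ^ exponent (m, n)"
  by (simp add: exponent_def pent_term_def power_add power_mult)

lemma has_sum_exponent:
  assumes "nome q"
  shows "((\<lambda>(m, n). (- 1) powi m * (- 1) powi n * q ^ exponent (m, n)) has_sum
    q ^ N * (euler_prod (q ^ r) * euler_prod (q ^ s))) UNIV"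
proof -
  have "((\<lambda>(m, n). pent_term (q ^ r) m * pent_term (q ^ s) n) has_sum
      euler_prod (q ^ r) * euler_prod (q ^ s)) (UNIV \<times> UNIV)"
    using assms r_pos s_pos by (intro has_sum_mult_Times pentagonal_number_theorem nome_power)
  from has_sum_cmult_right[OF this, of "q ^ N"] show ?thesis
    by (simp add: case_prod_unfold pent_term_mult_eq)
qed

lemma hecke_T5_eta_product:
  fixes \<tau> :: complex
  assumes "Im \<tau> > 0"
  defines "y \<equiv> q_pow \<tau> (1 / 5)"
  shows "hecke_T5 eta_product \<tau> =
    y ^ N * infsum (\<lambda>(m, n). pent_term (y ^ r) m * pent_term (y ^ s) n) {i. 5 dvd exponent i} +
    eta_product (5 * \<tau>)"
proof -
  have "((\<lambda>i. (- 1) powi fst i * (- 1) powi snd i * q_pow t 1 ^ exponent i) has_sum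
      eta_product t) UNIV"
    if "Im t > 0" for t
    using has_sum_exponent[OF nome_q_pow[OF that, of 1]] q_pow_power[of t 1 N]
    by (simp add: eta_product_eq_euler_prod case_prod_unfold)
  from hecke_T5_of_has_sum[OF this assms(1)]
  have "hecke_T5 eta_product \<tau> =
      infsum (\<lambda>(m, n). (- 1) powi m * (- 1) powi n * y ^ exponent (m, n)) {i. 5 dvd exponent i} +
      eta_product (5 * \<tau>)"
    by (simp add: y_def case_prod_unfold)
  also have "infsum (\<lambda>(m, n). (- 1) powi m * (- 1) powi n * y ^ exponent (m, n))
        {i. 5 dvd exponent i} =
      y ^ N * infsum (\<lambda>(m, n). pent_term (y ^ r) m * pent_term (y ^ s) n) {i. 5 dvd exponent i}"
    unfolding pent_term_mult_eq[symmetric] by (simp add: case_prod_unfold infsum_cmult_right')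
  finally show ?thesis .
qed

lemma eta_product_5:
  fixes \<tau> :: complex
  assumes "Im \<tau> > 0"
  defines "y \<equiv> q_pow \<tau> (1 / 5)"
  shows "eta_product (5 * \<tau>) = y ^ N * (euler_part (y ^ r) 1 * euler_part (y ^ s) 1)"
proof -
  have nome_y: "nome y"
    unfolding y_def using assms by (intro nome_q_pow) auto
  have "q_pow (5 * \<tau>) a = q_pow \<tau> (5 * a)" for a
    using q_pow_of_real_mult[of 5 \<tau> a] by simp
  hence "q_pow (5 * \<tau>) 1 = y ^ 25" "q_pow (5 * \<tau>) N = (y ^ 25) ^ N"
    by (simp_all add: y_def q_pow_power mult.commute)
  moreover have "(y ^ 25) ^ N = y ^ N * (y ^ r * y ^ s)"
    using r_plus_s by (simp flip: power_mult power_add)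
  moreover have "(y ^ 25) ^ k = (y ^ k) ^ 25" for k
    by (simp add: mult.commute flip: power_mult)
  ultimately show ?thesis
    unfolding euler_part_1[OF nome_power[OF nome_y r_pos]]
      euler_part_1[OF nome_power[OF nome_y s_pos]]
    by (simp add: eta_product_eq_euler_prod)
qed

lemma five_dvd_exponent_iff:
  "5 dvd exponent (m, n) \<longleftrightarrow>
   (5 :: int) dvd int r * (int (pentagonal m) - 1) + int s * (int (pentagonal n) - 1)"
proof -
  have "int r + int s = 24 * int N"
    using r_plus_s by simp
  hence "int (exponent (m, n)) =
      5 * (5 * int N) + (int r * (int (pentagonal m) - 1) + int s * (int (pentagonal n) - 1))"
    by (simp add: exponent_def algebra_simps)
  hence "5 dvd int (exponent (m, n)) \<longleftrightarrow>
      5 dvd int r * (int (pentagonal m) - 1) + int s * (int (pentagonal n) - 1)"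
    by (metis dvd_add_right_iff dvd_triv_left)
  thus ?thesis
    using int_dvd_int_iff[of 5 "exponent (m, n)"] by simp
qed

lemma infsum_pent_term_pent_classes:
  assumes "nome q"
    and "\<And>m n. 5 dvd exponent (m, n) \<longleftrightarrow> pentagonal n mod 5 = \<pi> (pentagonal m mod 5)"
    and "\<And>k. k < 3 \<Longrightarrow> \<pi> k < 3"
  shows "infsum (\<lambda>(m, n). pent_term (q ^ r) m * pent_term (q ^ s) n) {i. 5 dvd exponent i} =
    (\<Sum>k<3. euler_part (q ^ r) k * euler_part (q ^ s) (\<pi> k))"
proof -
  have "pentagonal m mod 5 < 3" for m
    by (simp add: pentagonal_mod_5)
  hence "{i. 5 dvd exponent i} = (\<Union>k\<in>{..<3}. pent_class k \<times> pent_class (\<pi> k))"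
    using assms(2) by auto
  moreover have "((\<lambda>(m, n). pent_term (q ^ r) m * pent_term (q ^ s) n) has_sum
      (\<Sum>k<3. euler_part (q ^ r) k * euler_part (q ^ s) (\<pi> k)))
      (\<Union>k\<in>{..<3}. pent_class k \<times> pent_class (\<pi> k))"
    using assms(1,3) r_pos s_pos
    by (intro sum_has_sum has_sum_mult_Times has_sum_pent_term_pent_class nome_power) auto
  ultimately show ?thesis
    by (simp add: infsumI)
qed

lemma hecke_T5_eta_product_pent_classes:
  fixes \<tau> :: complex
  assumes "Im \<tau> > 0"
    and "\<And>m n. 5 dvd exponent (m, n) \<longleftrightarrow> pentagonal n mod 5 = \<pi> (pentagonal m mod 5)"
    and "\<And>k. k < 3 \<Longrightarrow> \<pi> k < 3"
  defines "y \<equiv> q_pow \<tau> (1 / 5)"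
  shows "hecke_T5 eta_product \<tau> = y ^ N *
    ((\<Sum>k<3. euler_part (y ^ r) k * euler_part (y ^ s) (\<pi> k)) +
     euler_part (y ^ r) 1 * euler_part (y ^ s) 1)"
proof -
  have "nome y"
    unfolding y_def using assms(1) by (intro nome_q_pow) auto
  thus ?thesis
    using hecke_T5_eta_product[OF assms(1)] eta_product_5[OF assms(1)]
      infsum_pent_term_pent_classes[OF _ assms(2,3), of y]
    by (simp add: y_def distrib_left)
qed

lemma five_dvd_exponent_iff_of_dvd_add:
  assumes "5 dvd r + s" "\<not> 5 dvd r"
  shows "5 dvd exponent (m, n) \<longleftrightarrow> pentagonal n mod 5 = pentagonal m mod 5"
proof -
  have "(5 :: int) dvd int r + int s"
    using assms(1) by presburger
  hence "5 dvd (int r + int s) * (int (pentagonal n) - 1)"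
    by simp
  moreover have "int r * (int (pentagonal m) - 1) + int s * (int (pentagonal n) - 1) =
      (int r + int s) * (int (pentagonal n) - 1) +
      int r * (int (pentagonal m) - int (pentagonal n))"
    by (simp add: algebra_simps)
  ultimately have "5 dvd exponent (m, n) \<longleftrightarrow> 5 dvd int r * (int (pentagonal m) - int (pentagonal n))"
    unfolding five_dvd_exponent_iff by (simp only: dvd_add_right_iff)
  also have "\<dots> \<longleftrightarrow> 5 dvd int (pentagonal m) - int (pentagonal n)"
    using assms(2) int_dvd_int_iff[of 5 r] by (simp add: prime_dvd_mult_iff)
  also have "\<dots> \<longleftrightarrow> int (pentagonal m) mod 5 = int (pentagonal n) mod 5"
    by (rule mod_eq_dvd_iff[symmetric])
  finally show ?thesis
    using cong_int_iff[of "pentagonal m" "pentagonal n" 5] by (auto simp: cong_def)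
qed

lemma five_dvd_exponent_iff_of_mod_eq:
  assumes "r mod 5 = s mod 5" "\<not> 5 dvd r"
  shows "5 dvd exponent (m, n) \<longleftrightarrow> pentagonal n mod 5 = 2 - pentagonal m mod 5"
proof -
  have "5 dvd int s - int r"
    using assms(1) by presburger
  hence "5 dvd (int s - int r) * (int (pentagonal n) - 1)"
    by simp
  moreover have "int r * (int (pentagonal m) - 1) + int s * (int (pentagonal n) - 1) =
      (int s - int r) * (int (pentagonal n) - 1) +
      int r * (int (pentagonal m) + int (pentagonal n) - 2)"
    by (simp add: algebra_simps)
  ultimately have "5 dvd exponent (m, n) \<longleftrightarrow>
      5 dvd int r * (int (pentagonal m) + int (pentagonal n) - 2)"
    unfolding five_dvd_exponent_iff by (simp only: dvd_add_right_iff)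
  also have "\<dots> \<longleftrightarrow> 5 dvd int (pentagonal m) + int (pentagonal n) - 2"
    using assms(2) int_dvd_int_iff[of 5 r] by (simp add: prime_dvd_mult_iff)
  also have "\<dots> \<longleftrightarrow> (pentagonal m mod 5 + pentagonal n mod 5) mod 5 = 2"
    using mod_eq_dvd_iff[of "int (pentagonal m + pentagonal n)" 5 2]
      cong_int_iff[of "pentagonal m + pentagonal n" 2 5]
    by (simp add: cong_def mod_add_eq)
  also have "\<dots> \<longleftrightarrow> pentagonal n mod 5 = 2 - pentagonal m mod 5"
    by (simp add: pentagonal_mod_5)
  finally show ?thesis .
qed

theorem hecke_T5_eta_product_of_dvd_add:
  fixes \<tau> :: complex
  assumes "5 dvd r + s" "\<not> 5 dvd r" "Im \<tau> > 0"
  defines "q \<equiv> q_pow \<tau> 1"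
  shows "hecke_T5 eta_product \<tau> =
    q_pow \<tau> (N / 5) * (euler_prod (q ^ r) * euler_prod (q ^ s)) * RR_U r s q ^ 2"
proof -
  define y where "y = q_pow \<tau> (1 / 5)"
  have y_powers: "y ^ 5 = q" "y ^ N = q_pow \<tau> (N / 5)"
    by (simp_all add: q_def y_def q_pow_power)
  have y_power_5: "(y ^ k) ^ 5 = q ^ k" for k
    unfolding y_powers(1)[symmetric] by (simp add: mult.commute flip: power_mult)
  have "hecke_T5 eta_product \<tau> = y ^ N *
      ((\<Sum>k<3. euler_part (y ^ r) k * euler_part (y ^ s) k) +
       euler_part (y ^ r) 1 * euler_part (y ^ s) 1)"
    unfolding y_def using assms(3) five_dvd_exponent_iff_of_dvd_add[OF assms(1,2)]
    by (intro hecke_T5_eta_product_pent_classes)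
  also have "\<dots> = y ^ N * (euler_prod (q ^ r) * euler_prod (q ^ s)) *
      (RR_G5 (y ^ r) * RR_G5 (y ^ s) + RR_H5 (y ^ r) * RR_H5 (y ^ s)) ^ 2"
    by (simp add: euler_part_def y_power_5 numeral_3_eq_3 power2_eq_square algebra_simps)
  finally show ?thesis
    unfolding RR_U_of_dvd_add[OF assms(1), symmetric] y_powers .
qed

theorem hecke_T5_eta_product_of_mod_eq:
  fixes \<tau> :: complex
  assumes "r mod 5 = s mod 5" "\<not> 5 dvd r" "Im \<tau> > 0"
  defines "q \<equiv> q_pow \<tau> 1"
  shows "hecke_T5 eta_product \<tau> =
    - (q_pow \<tau> ((N + 2 * r) / 5) * (euler_prod (q ^ r) * euler_prod (q ^ s)) * RR_U r s q ^ 2)"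
proof -
  define y where "y = q_pow \<tau> (1 / 5)"
  have y_powers: "y ^ 5 = q" "y ^ N * (y ^ r) ^ 2 = q_pow \<tau> ((N + 2 * r) / 5)"
    by (simp_all add: q_def y_def q_pow_power add_divide_distrib flip: q_pow_add)
  have y_power_5: "(y ^ k) ^ 5 = q ^ k" for k
    unfolding y_powers(1)[symmetric] by (simp add: mult.commute flip: power_mult)
  have "y \<noteq> 0"
    by (simp add: y_def q_pow_def)
  note RR_U_eq = RR_U_of_mod_eq[OF assms(1,2) this, unfolded y_powers(1)]
  have "hecke_T5 eta_product \<tau> = y ^ N *
      ((\<Sum>k<3. euler_part (y ^ r) k * euler_part (y ^ s) (2 - k)) +
       euler_part (y ^ r) 1 * euler_part (y ^ s) 1)"
    unfolding y_def using assms(3) five_dvd_exponent_iff_of_mod_eq[OF assms(1,2)]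
    by (intro hecke_T5_eta_product_pent_classes) auto
  also have "\<dots> = - (y ^ N * (euler_prod (q ^ r) * euler_prod (q ^ s)) * (y ^ r * RR_U r s q) ^ 2)"
    unfolding RR_U_eq
    by (simp add: euler_part_def y_power_5 numeral_3_eq_3 power2_eq_square algebra_simps)
  finally show ?thesis
    unfolding y_powers(2)[symmetric] by (simp add: power_mult_distrib mult_ac)
qed

end

theorem theorem1p1:
  fixes r s :: nat and \<tau> q :: complex
  assumes "r > 0" and "s > 0"
    and "[r + s = 0] (mod 24)"
    and "\<not> (5 dvd r \<and> 5 dvd s)"
    and "Im \<tau> > 0"
    and "q = exp (2 * of_real pi * \<i> * \<tau>)"
  shows "([r + s = 0] (mod 5) \<longrightarrow>
           hecke_T5 (\<lambda>t. dedekind_eta (of_nat r * t) * dedekind_eta (of_nat s * t)) \<tau> =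
             dedekind_eta (of_nat r * \<tau>) * dedekind_eta (of_nat s * \<tau>) *
               (q_pow \<tau> (- (real r + real s) / 60) * RR_U r s q) ^ 2) \<and>
         ([int r - int s = 0] (mod 5) \<longrightarrow>
           hecke_T5 (\<lambda>t. dedekind_eta (of_nat r * t) * dedekind_eta (of_nat s * t)) \<tau> =
             - (dedekind_eta (of_nat r * \<tau>) * dedekind_eta (of_nat s * \<tau>) *
               (q_pow \<tau> ((11 * real r - real s) / 60) * RR_U r s q) ^ 2))"
proof -
  obtain N where "r + s = 24 * N"
    using assms(3) by (auto simp: cong_0_iff)
  then interpret eta_pair r s N
    using assms(1,2) by unfold_locales
  have q_eq: "q = q_pow \<tau> 1"
    using assms(6) by (simp add: q_pow_def)
  have eta_product: "(\<lambda>t. dedekind_eta (of_nat r * t) * dedekind_eta (of_nat s * t)) = eta_product"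
    "dedekind_eta (of_nat r * \<tau>) * dedekind_eta (of_nat s * \<tau>) = eta_product \<tau>"
    by (auto simp: eta_product_def)
  have twist: "eta_product \<tau> * (q_pow \<tau> a * u) ^ 2 =
      q_pow \<tau> (N + 2 * a) * (euler_prod (q ^ r) * euler_prod (q ^ s)) * u ^ 2" for a :: real and u
    by (simp add: eta_product_eq_euler_prod q_eq q_pow_add q_pow_power power_mult_distrib mult_ac)
  have exponents: "real N + 2 * (- (real r + real s) / 60) = N / 5"
    "real N + 2 * ((11 * real r - real s) / 60) = (N + 2 * r) / 5"
    using real_r_plus_s by (simp_all add: field_simps)
  have "5 dvd r + s \<and> \<not> 5 dvd r" if "[r + s = 0] (mod 5)"
    using that assms(4) by (auto simp: cong_0_iff dvd_add_right_iff)
  moreover have "r mod 5 = s mod 5 \<and> \<not> 5 dvd r" if "[int r - int s = 0] (mod 5)"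
    using that assms(4) unfolding cong_def by presburger
  ultimately show ?thesis
    unfolding eta_product twist exponents
    using hecke_T5_eta_product_of_dvd_add hecke_T5_eta_product_of_mod_eq assms(5) q_eq by simp
qed

end
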